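(* Let $0<\alpha<2$ and let $\delta=\delta(\alpha)=\min\{1/4,(3C)^{-1/(1+\alpha)}\}$ with $C=2^{\alpha+1}(1+2\alpha)$. Let $\rho$ be a classical solution on $\mathbb{T}\times[0,\infty)$ of $\partial_t\rho+\partial_x(\rho u)=0$, $u=H\Lambda^{\alpha-1}\rho$, with smooth $1$-periodic initial datum $\rho_0$ satisfying (H1), (H2), (H3). Then $u(x,t)\le0$ for all $x\in[0,\delta]$ and all $t\ge0$.
   Context: $\mathbb{T}=\mathbb{R}/\mathbb{Z}$ identified with $[-1/2,1/2)$; functions on $\mathbb{T}$ are identified with their $1$-periodic extensions. $u(x,t)=c_\alpha\,\mathrm{P.V.}\int_{\mathbb{R}}\frac{\rho(y,t)-\rho(x,t)}{\mathrm{sgn}(x-y)|x-y|^{\alpha}}dy$ with $c_\alpha>0$ the constant for which $\Lambda^\alpha f(x)=c_\alpha\,\mathrm{P.V.}\int_{\mathbb{R}}\frac{f(x)-f(y)}{|x-y|^{1+\alpha}}dy$. (H1) $\rho_0(x)=\rho_0(-x)$; (H2) $0\le\rho_0\le\rho_{\max}$ for a constant $\rho_{\max}>0$; (H3) $\rho_0(0)=0$ and $\partial_x\rho_0\ge0$ on $[0,1/2]$. *)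

theory Defs
  imports "HOL-Analysis.Analysis"
begin

text \<open>Functions on the torus are identified with their 1-periodic extensions to the real line.
  A density is a function rho :: real => real => real, with rho x t the value at position x, time t.\<close>

definition periodic1 :: "(real \<Rightarrow> real) \<Rightarrow> bool" where
  "periodic1 f \<longleftrightarrow> (\<forall>x. f (x + 1) = f x)"

definition smooth_fun :: "(real \<Rightarrow> real) \<Rightarrow> bool" where
  "smooth_fun f \<longleftrightarrow> (\<forall>n x. ((deriv ^^ n) f) differentiable (at x))"

text \<open>The constant of the one-dimensional fractional Laplacian:
  Lambda^alpha f(x) = c_alpha P.V. int (f x - f y)/|x-y|^(1+alpha) dy.\<close>
definition c_alpha :: "real \<Rightarrow> real" where
  "c_alpha \<alpha> = \<alpha> * 2 powr (\<alpha> - 1) * Gamma ((1 + \<alpha>) / 2) / (sqrt pi * Gamma (1 - \<alpha> / 2))"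

definition pv_trunc :: "real \<Rightarrow> (real \<Rightarrow> real \<Rightarrow> real) \<Rightarrow> real \<Rightarrow> real \<Rightarrow> real \<Rightarrow> real \<Rightarrow> real" where
  "pv_trunc \<alpha> \<rho> x t \<epsilon> R =
     integral {y. \<epsilon> < \<bar>x - y\<bar> \<and> \<bar>x - y\<bar> < R}
       (\<lambda>y. (\<rho> y t - \<rho> x t) / (sgn (x - y) * \<bar>x - y\<bar> powr \<alpha>))"

definition pv_converges :: "real \<Rightarrow> (real \<Rightarrow> real \<Rightarrow> real) \<Rightarrow> real \<Rightarrow> real \<Rightarrow> bool" where
  "pv_converges \<alpha> \<rho> x t \<longleftrightarrow>
     (\<exists>v. ((\<lambda>p. pv_trunc \<alpha> \<rho> x t (fst p) (snd p)) \<longlongrightarrow> v) (at_right 0 \<times>\<^sub>F at_top))"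

definition velocity :: "real \<Rightarrow> (real \<Rightarrow> real \<Rightarrow> real) \<Rightarrow> real \<Rightarrow> real \<Rightarrow> real" where
  "velocity \<alpha> \<rho> x t =
     c_alpha \<alpha> * Lim (at_right 0 \<times>\<^sub>F at_top) (\<lambda>p. pv_trunc \<alpha> \<rho> x t (fst p) (snd p))"

definition classical_solution :: "real \<Rightarrow> (real \<Rightarrow> real) \<Rightarrow> (real \<Rightarrow> real \<Rightarrow> real) \<Rightarrow> bool" where
  "classical_solution \<alpha> \<rho>0 \<rho> \<longleftrightarrow>
     (\<forall>x t. 0 \<le> t \<longrightarrow> \<rho> (x + 1) t = \<rho> x t) \<and>
     (\<forall>x. \<rho> x 0 = \<rho>0 x) \<and>
     (\<exists>\<rho>x \<rho>t.
        continuous_on (UNIV \<times> {0..}) (\<lambda>(x, t). \<rho> x t) \<and>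
        continuous_on (UNIV \<times> {0..}) (\<lambda>(x, t). \<rho>x x t) \<and>
        continuous_on (UNIV \<times> {0..}) (\<lambda>(x, t). \<rho>t x t) \<and>
        (\<forall>x t. 0 \<le> t \<longrightarrow>
           ((\<lambda>y. \<rho> y t) has_real_derivative \<rho>x x t) (at x) \<and>
           ((\<lambda>s. \<rho> x s) has_real_derivative \<rho>t x t) (at t within {0..})) \<and>
        (\<forall>x t. 0 \<le> t \<longrightarrow> pv_converges \<alpha> \<rho> x t) \<and>
        (\<forall>x t. 0 < t \<longrightarrow>
           (\<exists>F'. ((\<lambda>y. \<rho> y t * velocity \<alpha> \<rho> y t) has_real_derivative F') (at x) \<and>
                 \<rho>t x t + F' = 0)))"

definition C_const :: "real \<Rightarrow> real" where
  "C_const \<alpha> = 2 powr (\<alpha> + 1) * (1 + 2 * \<alpha>)"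

definition delta_const :: "real \<Rightarrow> real" where
  "delta_const \<alpha> = min (1/4) ((3 * C_const \<alpha>) powr (- 1 / (1 + \<alpha>)))"

end

theory Submission
  imports Defs
begin

text \<open>
  The argument is a maximum principle for the antiderivative \<open>Q(x,t)\<close> of the density, which
  is twice differentiable in \<open>x\<close> and satisfies \<open>Q\<^sub>t = J(t) - \<rho> u\<close>. Since \<open>u(x)\<close> is, up to a
  positive constant, the integral of \<open>2 Q(x) - Q(x - z) - Q(x + z)\<close> against \<open>z\<close> to the power \<open>- 1 - \<alpha>\<close>,
  no regularity of \<open>\<rho>\<close> beyond the first derivative is needed. Comparing values of \<open>Q\<close> at a
  spatial maximum shows in turn that \<open>\<rho>\<close> stays nonnegative (the mass between two zeros of \<open>\<rho>\<close>
  is conserved), that \<open>Q\<close> stays odd, and that the second differences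
  \<open>Q(x + z) + Q(x - z) - 2 Q(x)\<close> stay nonnegative for \<open>0 \<le> x \<le> 1/2\<close>. The last property says that
  \<open>\<rho>\<close> stays nondecreasing on half a period, and it makes \<open>u\<close> nonpositive on all of \<open>[0, 1/2]\<close>.
\<close>

section \<open>Integrals against a power kernel and the sign of their limit\<close>

text \<open>The points \<open>x - z\<close> and \<open>x + z\<close> of the truncated principal
  value are folded together, so the singular kernel lives on the half line.\<close>

definition sym_trunc :: "real \<Rightarrow> (real \<Rightarrow> real) \<Rightarrow> real \<Rightarrow> real \<Rightarrow> real \<Rightarrow> real" where
  "sym_trunc \<alpha> f x \<epsilon> R = integral {\<epsilon>..R} (\<lambda>z. (f (x - z) - f (x + z)) * z powr (- \<alpha>))"

text \<open>\<open>A\<close> collects the boundary terms of three integrations by parts; the remaining integrand is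
  a negative multiple of \<open>J\<close>.\<close>

lemma powr_kernel_integral_le:
  fixes \<alpha> \<epsilon> R :: real
  assumes "0 < \<alpha>" "0 < \<epsilon>" "\<epsilon> \<le> R"
    and cont: "continuous_on {\<epsilon>..R} g"
    and T: "\<And>z. (T has_real_derivative g z) (at z)"
    and I: "\<And>z. (I has_real_derivative T z) (at z)"
    and J: "\<And>z. (J has_real_derivative I z) (at z)"
    and Jle: "\<And>z. 0 \<le> z \<Longrightarrow> J z \<le> 0"
  defines "A \<equiv> \<lambda>z. T z * z powr (- \<alpha>) + \<alpha> * I z * z powr (- \<alpha> - 1)
                    + \<alpha> * (\<alpha> + 1) * J z * z powr (- \<alpha> - 2)"
  shows "integral {\<epsilon>..R} (\<lambda>z. g z * z powr (- \<alpha>)) \<le> A R - A \<epsilon>"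
proof -
  let ?A' = "\<lambda>z. g z * z powr (- \<alpha>) - \<alpha> * (\<alpha> + 1) * (\<alpha> + 2) * J z * z powr (- \<alpha> - 3)"
  have "(A has_vector_derivative ?A' z) (at z within {\<epsilon>..R})" if "z \<in> {\<epsilon>..R}" for z
  proof -
    have z: "0 < z" using that assms by auto
    have *: "(A has_real_derivative
       (g z * z powr (- \<alpha>) + T z * (- \<alpha> * z powr (- \<alpha> - 1))
       + (\<alpha> * T z * z powr (- \<alpha> - 1) + \<alpha> * I z * ((- \<alpha> - 1) * z powr (- \<alpha> - 1 - 1)))
       + (\<alpha> * (\<alpha> + 1) * I z * z powr (- \<alpha> - 2) + \<alpha> * (\<alpha> + 1) * J z * ((- \<alpha> - 2) * z powr (- \<alpha> - 2 - 1)))))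
       (at z)"
      unfolding A_def
      by (rule derivative_eq_intros T I J has_real_derivative_powr[OF z] refl
           | simp add: algebra_simps)+
    have e: "- \<alpha> - 1 - 1 = - \<alpha> - 2" "- \<alpha> - 2 - 1 = - \<alpha> - 3" by auto
    have "(A has_real_derivative ?A' z) (at z)"
      using * unfolding e by (rule DERIV_cong) (simp add: algebra_simps)
    then show ?thesis
      using has_real_derivative_iff_has_vector_derivative has_vector_derivative_at_within by blast
  qed
  then have h: "(?A' has_integral (A R - A \<epsilon>)) {\<epsilon>..R}"
    by (intro fundamental_theorem_of_calculus assms) auto
  have "continuous_on {\<epsilon>..R} (\<lambda>z. g z * z powr (- \<alpha>))"
    using \<open>0 < \<epsilon>\<close> by (intro continuous_intros cont) auto
  then have i: "(\<lambda>z. g z * z powr (- \<alpha>)) integrable_on {\<epsilon>..R}"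
    by (rule integrable_continuous_real)
  have "\<alpha> * (\<alpha> + 1) * (\<alpha> + 2) * J z * z powr (- \<alpha> - 3) \<le> 0" if "z \<in> {\<epsilon>..R}" for z
    using that assms Jle[of z] by (intro mult_nonpos_nonneg mult_nonneg_nonpos) auto
  then show ?thesis
    using integral_le[OF i has_integral_integrable[OF h]] integral_unique[OF h] by force
qed

text \<open>By the mean value theorem each antiderivative gains one power of \<open>z\<close>. The
  constant \<open>C\<close> is kept rather than divided by \<open>n + 1\<close>, since only the
  power matters later.\<close>

lemma abs_le_power_Suc_of_deriv:
  fixes h h' :: "real \<Rightarrow> real"
  assumes d: "\<And>z. (h has_real_derivative h' z) (at z)" and "h 0 = 0"
    and b: "\<And>z. 0 \<le> z \<Longrightarrow> z \<le> \<eta> \<Longrightarrow> \<bar>h' z\<bar> \<le> C * z ^ n"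
    and z: "0 \<le> z" "z \<le> \<eta>" and "0 \<le> C"
  shows "\<bar>h z\<bar> \<le> C * z ^ Suc n"
proof (cases "z = 0")
  case False
  then have "0 < z" using z by simp
  then obtain w where w: "0 < w" "w < z" "h z - h 0 = (z - 0) * h' w"
    using MVT2[of 0 z h h'] d by blast
  have "\<bar>h z\<bar> = z * \<bar>h' w\<bar>" using w \<open>h 0 = 0\<close> \<open>0 < z\<close> by (simp add: abs_mult)
  also have "\<dots> \<le> z * (C * w ^ n)" using b[of w] w z by (intro mult_left_mono) auto
  also have "\<dots> \<le> z * (C * z ^ n)" using w z \<open>0 \<le> C\<close>
    by (intro mult_left_mono power_mono) auto
  finally show ?thesis by (simp add: mult.left_commute)
qed (use \<open>h 0 = 0\<close> in simp)

text \<open>The boundary terms vanish at both ends. Near 0 the bound on \<open>g\<close> gives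
  orders 2, 3, 4 for \<open>T\<close>, \<open>I\<close>, \<open>J\<close>, so
  \<open>A (1 / n)\<close> is of order n^(\<alpha> - 2), small because \<alpha> < 2. At infinity
  \<open>T\<close>, \<open>I\<close>, \<open>J\<close> have orders 0, 1, 2, so \<open>A n\<close> is
  of order n^(-\<alpha>), small because \<alpha> > 0.\<close>

lemma powr_kernel_limit_nonpos:
  fixes \<alpha> v :: real
  assumes \<alpha>: "0 < \<alpha>" "\<alpha> < 2"
    and cont: "continuous_on UNIV g"
    and T: "\<And>z. (T has_real_derivative g z) (at z)"
    and I: "\<And>z. (I has_real_derivative T z) (at z)"
    and J: "\<And>z. (J has_real_derivative I z) (at z)"
    and zero: "T 0 = 0" "I 0 = 0" "J 0 = 0"
    and Jle: "\<And>z. 0 \<le> z \<Longrightarrow> J z \<le> 0"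
    and near: "0 < \<eta>" "0 \<le> C" "\<And>z. 0 \<le> z \<Longrightarrow> z \<le> \<eta> \<Longrightarrow> \<bar>g z\<bar> \<le> C * z"
    and far: "0 \<le> B" "\<And>z. 0 \<le> z \<Longrightarrow> \<bar>T z\<bar> \<le> B"
    and lim: "(\<lambda>n. integral {1 / real n..real n} (\<lambda>z. g z * z powr (- \<alpha>))) \<longlonglongrightarrow> v"
  shows "v \<le> 0"
proof -
  define A where "A z = T z * z powr (- \<alpha>) + \<alpha> * I z * z powr (- \<alpha> - 1)
                    + \<alpha> * (\<alpha> + 1) * J z * z powr (- \<alpha> - 2)" for z
  define c where "c = 1 + \<alpha> + \<alpha> * (\<alpha> + 1)"
  \<comment> \<open>The three terms of \<open>A\<close> scale alike, and \<open>c\<close> adds up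
    their coefficients. The bound serves with \<open>k = 2\<close> near 0 and with
    \<open>k = 0\<close> at infinity.\<close>
  have A_bound: "\<bar>A z\<bar> \<le> c * (D * z powr (real k - \<alpha>))"
    if z: "0 < z" and D: "0 \<le> D" and h: "\<bar>T z\<bar> \<le> D * z ^ k" "\<bar>I z\<bar> \<le> D * z ^ Suc k"
      "\<bar>J z\<bar> \<le> D * z ^ Suc (Suc k)" for z D and k :: nat
  proof -
    have p: "D * z ^ m * z powr a = D * z powr (real m + a)" for m a
      using z by (simp add: powr_add powr_realpow)
    have m: "\<bar>x\<bar> * z powr a \<le> D * z ^ m * z powr a" if "\<bar>x\<bar> \<le> D * z ^ m" for x m a
      using that by (intro mult_right_mono) auto
    have 1: "\<bar>T z\<bar> * z powr (- \<alpha>) \<le> D * z powr (real k - \<alpha>)"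
      using m[OF h(1), of "- \<alpha>"] unfolding p by simp
    have 2: "\<bar>I z\<bar> * z powr (- \<alpha> - 1) \<le> D * z powr (real k - \<alpha>)"
      using m[OF h(2), of "- \<alpha> - 1"] unfolding p by simp
    have 3: "\<bar>J z\<bar> * z powr (- \<alpha> - 2) \<le> D * z powr (real k - \<alpha>)"
      using m[OF h(3), of "- \<alpha> - 2"] unfolding p by simp
    have "\<bar>A z\<bar> \<le> \<bar>T z\<bar> * z powr (- \<alpha>) + \<alpha> * (\<bar>I z\<bar> * z powr (- \<alpha> - 1))
       + \<alpha> * (\<alpha> + 1) * (\<bar>J z\<bar> * z powr (- \<alpha> - 2))"
      unfolding A_def using \<alpha>
      by (intro order_trans[OF abs_triangle_ineq] add_mono) (auto simp: abs_mult)
    also have "\<dots> \<le> D * z powr (real k - \<alpha>) + \<alpha> * (D * z powr (real k - \<alpha>))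
       + \<alpha> * (\<alpha> + 1) * (D * z powr (real k - \<alpha>))"
      using 1 2 3 \<alpha> by (intro add_mono mult_left_mono) auto
    finally show ?thesis by (simp add: c_def algebra_simps)
  qed
  have T2: "\<bar>T z\<bar> \<le> C * z ^ 2" if "0 \<le> z" "z \<le> \<eta>" for z
    using abs_le_power_Suc_of_deriv[OF T zero(1), of \<eta> C 1 z] near that by (simp add: power2_eq_square)
  have I3: "\<bar>I z\<bar> \<le> C * z ^ 3" if "0 \<le> z" "z \<le> \<eta>" for z
    using abs_le_power_Suc_of_deriv[OF I zero(2) T2, of \<eta> z] near that by (simp add: numeral_eq_Suc)
  have J4: "\<bar>J z\<bar> \<le> C * z ^ 4" if "0 \<le> z" "z \<le> \<eta>" for z
    using abs_le_power_Suc_of_deriv[OF J zero(3) I3, of \<eta> z] near that by (simp add: numeral_eq_Suc)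
  have I1: "\<bar>I z\<bar> \<le> B * z ^ 1" if "0 \<le> z" for z
    using abs_le_power_Suc_of_deriv[OF I zero(2), of z B 0 z] far that by simp
  have J2: "\<bar>J z\<bar> \<le> B * z ^ 2" if "0 \<le> z" for z
    using abs_le_power_Suc_of_deriv[OF J zero(3) I1, of z z] far that by (simp add: numeral_eq_Suc)
  have b0: "\<bar>A (1 / real n)\<bar> \<le> c * (C * (1 / real n) powr (2 - \<alpha>))" if "n > 0" "1 / real n \<le> \<eta>" for n
    using A_bound[of "1 / real n" C 2] T2[of "1 / real n"] I3[of "1 / real n"] J4[of "1 / real n"]
      near that by (simp add: numeral_eq_Suc)
  have b1: "\<bar>A (real n)\<bar> \<le> c * (B * real n powr (- \<alpha>))" if "n > 0" for n
    using A_bound[of "real n" B 0] far I1[of "real n"] J2[of "real n"] that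
    by (simp add: numeral_eq_Suc)
  have ev: "\<forall>\<^sub>F n in sequentially. 1 / real n < \<eta>"
    using order_tendstoD(2)[OF lim_1_over_n near(1)] .
  have "\<forall>\<^sub>F n in sequentially. integral {1 / real n..real n} (\<lambda>z. g z * z powr (- \<alpha>))
      \<le> c * (B * real n powr (- \<alpha>)) + c * (C * (1 / real n) powr (2 - \<alpha>))"
    using ev eventually_gt_at_top[of 0]
  proof eventually_elim
    case (elim n)
    then have n: "1 \<le> real n" "1 / real n \<le> 1" "1 / real n \<le> real n"
      by (auto intro: order_trans[of _ 1])
    have "integral {1 / real n..real n} (\<lambda>z. g z * z powr (- \<alpha>)) \<le> A (real n) - A (1 / real n)"
      unfolding A_def using elim n continuous_on_subset[OF cont]
      by (intro powr_kernel_integral_le \<alpha> T I J Jle) auto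
    with b0[of n] b1[of n] elim show ?case by linarith
  qed
  moreover have "(\<lambda>n. c * (B * real n powr (- \<alpha>)) + c * (C * (1 / real n) powr (2 - \<alpha>))) \<longlonglongrightarrow> 0"
  proof -
    have "(\<lambda>n. real n powr (- \<alpha>)) \<longlonglongrightarrow> 0"
      using \<alpha> by (intro tendsto_neg_powr filterlim_real_sequentially) auto
    moreover have "(\<lambda>n. (1 / real n) powr (2 - \<alpha>)) \<longlonglongrightarrow> 0"
      using tendsto_powr'[OF lim_1_over_n tendsto_const[of "2 - \<alpha>"]] \<alpha> by simp
    ultimately have "(\<lambda>n. c * (B * real n powr (- \<alpha>)) + c * (C * (1 / real n) powr (2 - \<alpha>)))
        \<longlonglongrightarrow> c * (B * 0) + c * (C * 0)"
      by (intro tendsto_intros)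
    then show ?thesis by simp
  qed
  ultimately show ?thesis
    using tendsto_le[OF sequentially_bot _ lim] by blast
qed

section \<open>Antiderivatives, and sign criteria through second differences\<close>

lemma continuous_on_of_DERIV:
  fixes f f' :: "real \<Rightarrow> real"
  assumes "\<And>x. (f has_real_derivative f' x) (at x)"
  shows "continuous_on S f"
  using assms DERIV_isCont continuous_at_imp_continuous_on by blast

lemma DERIV_zero_imp_const:
  fixes f :: "real \<Rightarrow> real"
  assumes "\<And>x. (f has_real_derivative 0) (at x)"
  shows "f x = f y"
  using DERIV_isconst_all assms by blast

lemma DERIV_compose_shift:
  fixes h h' :: "real \<Rightarrow> real"
  assumes h: "\<And>y. (h has_real_derivative h' y) (at y)"
  shows "((\<lambda>z. h (x + z)) has_real_derivative h' (x + z)) (at z)"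
    and "((\<lambda>z. h (x - z)) has_real_derivative - h' (x - z)) (at z)"
proof -
  have "((+) x has_real_derivative 1) (at z)" "((-) x has_real_derivative - 1) (at z)"
    by (auto intro!: derivative_eq_intros)
  then show "((\<lambda>z. h (x + z)) has_real_derivative h' (x + z)) (at z)"
    and "((\<lambda>z. h (x - z)) has_real_derivative - h' (x - z)) (at z)"
    using DERIV_chain2[OF h] by fastforce+
qed

text \<open>Differentiating under the integral gives the integral over s in [0, 1] of
  \<open>f (s * x) + x * (s * f' (s * x))\<close>. This integrand is the s-derivative of
  \<open>s * f (s * x)\<close>, so the integral is \<open>f x\<close>.\<close>

lemma DERIV_radial_integral:
  fixes f f' :: "real \<Rightarrow> real"
  assumes f: "\<And>x. (f has_real_derivative f' x) (at x)" and cont: "continuous_on UNIV f'"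
  shows "((\<lambda>x. x * integral {0..1} (\<lambda>s. f (s * x))) has_real_derivative f x) (at x)"
proof -
  have cf: "continuous_on S f" for S using continuous_on_of_DERIV[OF f] .
  have d: "((\<lambda>x. integral (cbox 0 1) (\<lambda>s. f (s * x))) has_real_derivative
      integral (cbox 0 1) (\<lambda>s. s * f' (s * x))) (at x within UNIV)"
  proof (rule leibniz_rule_field_derivative)
    fix y s :: real
    show "((\<lambda>y. f (s * y)) has_real_derivative s * f' (s * y)) (at y within UNIV)"
      using DERIV_chain2[OF f DERIV_cmult_Id[of s y]] by (simp add: mult.commute)
  next
    show "(\<lambda>s. f (s * y)) integrable_on cbox 0 1" for y
      by (intro integrable_continuous continuous_on_compose2[OF cf[of UNIV]] continuous_intros) auto
    show "continuous_on (UNIV \<times> cbox 0 1) (\<lambda>(y, s). s * f' (s * y))"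
      by (auto simp: case_prod_beta intro!: continuous_intros continuous_on_compose2[OF cont])
  qed auto
  have "((\<lambda>s. f (s * x) + x * (s * f' (s * x))) has_integral (1 * f (1 * x) - 0 * f (0 * x))) {0..1}"
  proof (rule fundamental_theorem_of_calculus)
    fix s :: real
    have "((\<lambda>s. f (s * x)) has_real_derivative f' (s * x) * x) (at s)"
      by (rule DERIV_chain2[OF f]) (auto intro!: derivative_eq_intros)
    then have "((\<lambda>s. s * f (s * x)) has_real_derivative f (s * x) + x * (s * f' (s * x))) (at s)"
      using DERIV_mult[OF DERIV_ident] by (fastforce simp: mult_ac)
    then show "((\<lambda>s. s * f (s * x)) has_vector_derivative f (s * x) + x * (s * f' (s * x)))
       (at s within {0..1})"
      using has_real_derivative_iff_has_vector_derivative has_vector_derivative_at_within by blast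
  qed simp
  then have "f x = integral {0..1} (\<lambda>s. f (s * x) + x * (s * f' (s * x)))"
    by (simp add: integral_unique)
  also have "\<dots> = integral {0..1} (\<lambda>s. f (s * x)) + integral {0..1} (\<lambda>s. x * (s * f' (s * x)))"
    by (intro integral_add integrable_continuous_real continuous_intros
        continuous_on_compose2[OF cf[of UNIV]] continuous_on_compose2[OF cont]) auto
  finally have e: "f x = integral {0..1} (\<lambda>s. f (s * x)) + x * integral {0..1} (\<lambda>s. s * f' (s * x))"
    by simp
  show ?thesis
    using DERIV_mult[OF DERIV_ident d] e by (simp add: mult.commute)
qed

lemma antiderivative_exists:
  fixes f f' :: "real \<Rightarrow> real"
  assumes "\<And>x. (f has_real_derivative f' x) (at x)" "continuous_on UNIV f'"
  obtains F where "\<And>x. (F has_real_derivative f x) (at x)"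
  using DERIV_radial_integral[OF assms] by blast

text \<open>The expression in the hypothesis \<open>J\<close> is the twofold integral from \<open>0\<close> to \<open>s\<close> of
  \<open>2 * f x - f (x - s) - f (x + s)\<close>.\<close>

lemma sym_trunc_limit_nonpos_double_integral:
  fixes \<alpha> v :: real
  assumes \<alpha>: "0 < \<alpha>" "\<alpha> < 2"
    and f: "\<And>y. (f has_real_derivative r y) (at y)"
    and r: "\<And>y. (r has_real_derivative r' y) (at y)"
    and F: "\<And>y. (F has_real_derivative f y) (at y)"
    and \<Phi>: "\<And>y. (\<Phi> has_real_derivative F y) (at y)"
    and B: "\<And>s. \<bar>2 * f x - f (x - s) - f (x + s)\<bar> \<le> B"
    and J: "\<And>s. 0 \<le> s \<Longrightarrow> s\<^sup>2 * f x - \<Phi> (x + s) - \<Phi> (x - s) + 2 * \<Phi> x \<le> 0"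
    and lim: "(\<lambda>n. sym_trunc \<alpha> r x (1 / real n) (real n)) \<longlonglongrightarrow> v"
  shows "v \<le> 0"
proof -
  note shift = DERIV_compose_shift[where x = x and z = z for z]
  define g where "g z = r (x - z) - r (x + z)" for z
  have "(g has_real_derivative - r' x - r' x) (at 0)"
    unfolding g_def using DERIV_diff[OF shift(2)[OF r, of 0] shift(1)[OF r, of 0]] by simp
  then have "(\<lambda>h. (g (0 + h) - g 0) / h) \<midarrow>0\<rightarrow> - r' x - r' x"
    by (simp add: DERIV_def)
  \<comment> \<open>Since \<open>g 0 = 0\<close>, differentiability at 0 bounds \<open>g z\<close>
    by a multiple of \<open>z\<close>: the quotient tends to \<open>- 2 * r' x\<close>, which
    explains the choice of \<open>C\<close> below.\<close>
  then have "\<forall>\<^sub>F h in at 0. \<bar>(g h / h) - (- r' x - r' x)\<bar> < 1"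
    using tendstoD[of "\<lambda>h. g h / h" "- r' x - r' x" "at 0" 1] by (simp add: g_def dist_real_def)
  then obtain d where d: "0 < d" "\<And>h. h \<noteq> 0 \<Longrightarrow> \<bar>h\<bar> < d \<Longrightarrow> \<bar>(g h / h) - (- r' x - r' x)\<bar> < 1"
    unfolding eventually_at by (auto simp: dist_real_def)
  define C where "C = 1 + \<bar>- r' x - r' x\<bar>"
  have near: "\<bar>g z\<bar> \<le> C * z" if "0 \<le> z" "z \<le> d / 2" for z
  proof (cases "z = 0")
    case False
    then have "\<bar>g z / z\<bar> \<le> C" using d that unfolding C_def by (smt (verit) field_sum_of_halves)
    then show ?thesis using False that by (simp add: field_simps abs_divide)
  qed (simp add: g_def)
  show ?thesis
  proof (rule powr_kernel_limit_nonpos[OF \<alpha>])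
    show "continuous_on UNIV g"
      unfolding g_def by (intro continuous_intros continuous_on_compose2[OF continuous_on_of_DERIV[OF r, of UNIV]]) auto
    show "((\<lambda>z. 2 * f x - f (x - z) - f (x + z)) has_real_derivative g z) (at z)" for z
      using DERIV_diff[OF DERIV_diff[OF DERIV_const[of "2 * f x"] shift(2)[OF f]] shift(1)[OF f], of z]
      by (simp add: g_def)
    show "((\<lambda>z. 2 * z * f x - F (x + z) + F (x - z)) has_real_derivative 2 * f x - f (x - z) - f (x + z)) (at z)" for z
      using DERIV_add[OF DERIV_diff[OF DERIV_cmult_Id[of "2 * f x"] shift(1)[OF F]] shift(2)[OF F], of z]
      by (simp add: mult_ac diff_diff_add) (simp add: algebra_simps)
    show "((\<lambda>z. z\<^sup>2 * f x - \<Phi> (x + z) - \<Phi> (x - z) + 2 * \<Phi> x) has_real_derivative 2 * z * f x - F (x + z) + F (x - z)) (at z)" for z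
      using DERIV_add[OF DERIV_diff[OF DERIV_diff[OF DERIV_cmult_right[OF DERIV_pow[of 2 z], of "f x"]
          shift(1)[OF \<Phi>]] shift(2)[OF \<Phi>]] DERIV_const[of "2 * \<Phi> x"]]
      by simp
    show "(\<lambda>n. integral {1 / real n..real n} (\<lambda>z. g z * z powr - \<alpha>)) \<longlonglongrightarrow> v"
      using lim unfolding sym_trunc_def g_def .
    show "0 < d / 2" "0 \<le> C" using d by (auto simp: C_def)
    show "0 \<le> B" using B[of 0] by simp
  qed (use J B near in auto)
qed

text \<open>Here \<open>2 * f x - f (x - s) - f (x + s)\<close> is itself nonpositive, and
  integrating twice from 0 keeps the sign. The criterion applies at global minima of
  \<open>f\<close>, and wherever all second differences of \<open>f\<close> are known to be
  nonnegative.\<close>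

lemma sym_trunc_limit_nonpos:
  fixes \<alpha> v :: real
  assumes \<alpha>: "0 < \<alpha>" "\<alpha> < 2"
    and f: "\<And>y. (f has_real_derivative r y) (at y)"
    and r: "\<And>y. (r has_real_derivative r' y) (at y)"
    and B: "\<And>s. \<bar>2 * f x - f (x - s) - f (x + s)\<bar> \<le> B"
    and conv: "\<And>s. 0 \<le> s \<Longrightarrow> 2 * f x \<le> f (x - s) + f (x + s)"
    and lim: "(\<lambda>n. sym_trunc \<alpha> r x (1 / real n) (real n)) \<longlonglongrightarrow> v"
  shows "v \<le> 0"
proof -
  obtain F where F: "\<And>y. (F has_real_derivative f y) (at y)"
    using antiderivative_exists[OF f continuous_on_of_DERIV[OF r]] by blast
  obtain \<Phi> where \<Phi>: "\<And>y. (\<Phi> has_real_derivative F y) (at y)"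
    using antiderivative_exists[OF F continuous_on_of_DERIV[OF f]] by blast
  note shift = DERIV_compose_shift[where x = x and z = z for z]
  have I: "2 * s * f x - F (x + s) + F (x - s) \<le> 0" if "0 \<le> s" for s
  proof -
    have "2 * s * f x - F (x + s) + F (x - s) \<le> 2 * 0 * f x - F (x + 0) + F (x - 0)"
    proof (rule DERIV_nonpos_imp_nonincreasing[OF that])
      fix z :: real assume "0 \<le> z" "z \<le> s"
      have "((\<lambda>s. 2 * s * f x - F (x + s) + F (x - s)) has_real_derivative 2 * f x - f (x - z) - f (x + z)) (at z)"
        using DERIV_add[OF DERIV_diff[OF DERIV_cmult_Id[of "2 * f x"] shift(1)[OF F]] shift(2)[OF F], of z]
        by (simp add: mult_ac diff_diff_add add.commute)
      moreover have "2 * f x - f (x - z) - f (x + z) \<le> 0" using conv[OF \<open>0 \<le> z\<close>] by simp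
      ultimately show "\<exists>y. ((\<lambda>s. 2 * s * f x - F (x + s) + F (x - s)) has_real_derivative y) (at z) \<and> y \<le> 0"
        by blast
    qed
    then show ?thesis by simp
  qed
  have J: "s\<^sup>2 * f x - \<Phi> (x + s) - \<Phi> (x - s) + 2 * \<Phi> x \<le> 0" if "0 \<le> s" for s
  proof -
    have "s\<^sup>2 * f x - \<Phi> (x + s) - \<Phi> (x - s) \<le> 0\<^sup>2 * f x - \<Phi> (x + 0) - \<Phi> (x - 0)"
    proof (rule DERIV_nonpos_imp_nonincreasing[OF that])
      fix z :: real assume "0 \<le> z" "z \<le> s"
      have "((\<lambda>s. s\<^sup>2 * f x - \<Phi> (x + s) - \<Phi> (x - s)) has_real_derivative 2 * z * f x - F (x + z) + F (x - z)) (at z)"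
        using DERIV_diff[OF DERIV_diff[OF DERIV_cmult_right[OF DERIV_pow[of 2 z], of "f x"]
          shift(1)[OF \<Phi>]] shift(2)[OF \<Phi>]]
        by simp
      then show "\<exists>y. ((\<lambda>s. s\<^sup>2 * f x - \<Phi> (x + s) - \<Phi> (x - s)) has_real_derivative y) (at z) \<and> y \<le> 0"
        using I[OF \<open>0 \<le> z\<close>] by blast
    qed
    then show ?thesis by simp
  qed
  show ?thesis
    using sym_trunc_limit_nonpos_double_integral[OF \<alpha> f r F \<Phi> B J lim] .
qed

text \<open>\<open>F (- x)\<close> and \<open>F x\<close> have the same derivative and agree at 0.
  The increment of \<open>F\<close> over a period is constant, and between -1/2 and 1/2 it is zero
  by evenness.\<close>

lemma odd_periodic_antiderivative:
  fixes f F :: "real \<Rightarrow> real"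
  assumes odd: "\<And>x. f (- x) = - f x" and per: "\<And>x. f (x + 1) = f x"
    and F: "\<And>x. (F has_real_derivative f x) (at x)"
  shows "F (- x) = F x" "F (x + 1) = F x"
proof -
  have neg: "((\<lambda>x. F (- x)) has_real_derivative f x) (at x)" for x
    using DERIV_compose_shift(2)[OF F, of 0 x] odd by simp
  have even: "F (- x) = F x" for x
    using DERIV_zero_imp_const[of "\<lambda>x. F (- x) - F x" x 0] DERIV_diff[OF neg F] by simp
  then show "F (- x) = F x" .
  have "((\<lambda>x. F (x + 1)) has_real_derivative f x) (at x)" for x
    using DERIV_compose_shift(1)[OF F, of 1 x] per[of x] by (simp add: add.commute[of 1])
  then have "F (x + 1) - F x = F (- 1 / 2 + 1) - F (- 1 / 2)"
    using DERIV_zero_imp_const[of "\<lambda>x. F (x + 1) - F x" x "- 1 / 2"] DERIV_diff[OF _ F] by fastforce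
  then show "F (x + 1) = F x" using even[of "1 / 2"] by simp
qed

lemma periodic_of_nat:
  fixes f :: "real \<Rightarrow> 'a"
  assumes "\<And>x. f (x + 1) = f x"
  shows "f (x + real n) = f x"
proof (induction n)
  case (Suc n)
  then show ?case using assms[of "x + real n"] by (simp add: algebra_simps)
qed simp

text \<open>Outside \<open>[0, 1/2]\<close> the function may drop below \<open>f x\<close>, so \<open>2 * f x - f (x - s) - f (x + s)\<close> has no
  sign; the odd reflections about \<open>0\<close> and \<open>1/2\<close> cancel after integrating twice.\<close>

lemma odd_periodic_min_second_difference:
  fixes f F \<Phi> :: "real \<Rightarrow> real"
  assumes odd: "\<And>x. f (- x) = - f x" and per: "\<And>x. f (x + 1) = f x"
    and F: "\<And>x. (F has_real_derivative f x) (at x)"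
    and \<Phi>: "\<And>x. (\<Phi> has_real_derivative F x) (at x)"
    and x: "0 \<le> x" "x \<le> 1 / 2" "f x \<le> 0"
    and min: "\<And>y. 0 \<le> y \<Longrightarrow> y \<le> 1 / 2 \<Longrightarrow> f x \<le> f y"
    and s: "0 \<le> s"
  shows "s\<^sup>2 * f x - \<Phi> (x + s) - \<Phi> (x - s) + 2 * \<Phi> x \<le> 0"
proof -
  note F_even = odd_periodic_antiderivative(1)[OF odd per F]
  note F_per = odd_periodic_antiderivative(2)[OF odd per F]
  \<comment> \<open>The minimum \<open>f x\<close> bounds the slope of \<open>F\<close> from below
    on [0, 1/2].\<close>
  have F_growth: "f x * (b - a) \<le> F b - F a" if "0 \<le> a" "a \<le> b" "b \<le> 1 / 2" for a b
  proof (cases "a = b")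
    case False
    then have "a < b" using that by simp
    then obtain w where w: "a < w" "w < b" "F b - F a = (b - a) * f w"
      using MVT2[OF _ F] by blast
    have "f x \<le> f w" using min[of w] w(1,2) that by linarith
    then have "(b - a) * f x \<le> (b - a) * f w" using \<open>a < b\<close> by (intro mult_left_mono) auto
    then show ?thesis using w(3) by (simp only: mult.commute)
  qed simp
  define N where "N z = F (x + z) - F (x - z)" for z
  have N_lower: "2 * z * f x \<le> N z" if z: "0 \<le> z" "z \<le> 1 / 2" for z
  proof -
    \<comment> \<open>Reflecting \<open>x + z\<close> about 1/2 and \<open>x - z\<close> about 0
      moves both into [0, 1/2] without changing \<open>F\<close>. The reflected points are at most
      \<open>2 * z\<close> apart, and since \<open>f x <= 0\<close> the growth bound can be weakened
      to that distance.\<close>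
    define b where "b = (if x + z \<le> 1 / 2 then x + z else 1 - x - z)"
    have "1 - x - z = - (x + z) + 1" by simp
    then have "F (1 - x - z) = F (x + z)"
      using F_per[of "- (x + z)"] F_even[of "x + z"] by metis
    then have "F (x + z) = F b" by (simp add: b_def)
    moreover have "F (x - z) = F \<bar>x - z\<bar>" using F_even[of "x - z"] by (metis abs_if)
    moreover have "f x * (b - \<bar>x - z\<bar>) \<le> F b - F \<bar>x - z\<bar>"
      using x z by (intro F_growth) (auto simp: b_def)
    moreover have "f x * (2 * z) \<le> f x * (b - \<bar>x - z\<bar>)"
      using x z by (intro mult_left_mono_neg) (auto simp: b_def)
    ultimately show ?thesis by (simp add: N_def mult.commute)
  qed
  define M where "M z = \<Phi> (x + z) + \<Phi> (x - z) - 2 * \<Phi> x" for z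
  have dM: "(M has_real_derivative N z) (at z)" for z
    unfolding M_def N_def
    using DERIV_diff[OF DERIV_add[OF DERIV_compose_shift(1)[OF \<Phi>, of x z]
        DERIV_compose_shift(2)[OF \<Phi>, of x z]] DERIV_const[of "2 * \<Phi> x"]] by simp
  have N_odd: "N (- z) = - N z" for z by (simp add: N_def)
  have N_per: "N (z + 1) = N z" for z
    using F_per[of "x + z"] F_per[of "x - z - 1"] by (simp add: N_def algebra_simps)
  note M_even = odd_periodic_antiderivative(1)[OF N_odd N_per dM]
  note M_per = odd_periodic_antiderivative(2)[OF N_odd N_per dM]
  have M_lower: "z\<^sup>2 * f x \<le> M z" if z: "0 \<le> z" "z \<le> 1 / 2" for z
  proof -
    have "M 0 - 0\<^sup>2 * f x \<le> M z - z\<^sup>2 * f x"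
    proof (rule DERIV_nonneg_imp_nondecreasing[OF z(1)])
      fix w assume "0 \<le> w" "w \<le> z"
      then have "0 \<le> N w - 2 * w * f x" using N_lower[of w] z by simp
      moreover have "((\<lambda>z. M z - z\<^sup>2 * f x) has_real_derivative N w - 2 * w * f x) (at w)"
        by (rule derivative_eq_intros dM refl | simp)+
      ultimately show "\<exists>y. ((\<lambda>z. M z - z\<^sup>2 * f x) has_real_derivative y) (at w) \<and> 0 \<le> y" by blast
    qed
    then show ?thesis by (simp add: M_def)
  qed
  \<comment> \<open>\<open>M\<close> is even and 1-periodic, so \<open>M s = M e\<close> for the
    distance \<open>e\<close> from \<open>s\<close> to the nearest integer. As \<open>e <= s\<close>
    and \<open>f x <= 0\<close>, the bound at \<open>e\<close> implies the one at
    \<open>s\<close>.\<close>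
  define q where "q = s - real (nat \<lfloor>s\<rfloor>)"
  have q: "0 \<le> q" "q < 1" "q \<le> s" "s = q + real (nat \<lfloor>s\<rfloor>)"
    unfolding q_def using s by linarith+
  have "M s = M q" using periodic_of_nat[of M q, OF M_per] q(4) by metis
  define e where "e = (if q \<le> 1 / 2 then q else 1 - q)"
  have "M q = M e" using M_per[of "- q"] M_even[of q] by (simp add: e_def)
  have e: "0 \<le> e" "e \<le> 1 / 2" "e \<le> s" using q by (auto simp: e_def)
  have "s\<^sup>2 * f x \<le> e\<^sup>2 * f x" using e x by (intro mult_right_mono_neg power_mono) auto
  also have "\<dots> \<le> M s" using M_lower[OF e(1,2)] \<open>M s = M q\<close> \<open>M q = M e\<close> by simp
  finally show ?thesis by (simp add: M_def)
qed

text \<open>For an odd function a minimum over the half period [0, 1/2] is in general no global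
  minimum, so the sign is taken from the twofold integral instead of the second difference
  itself.\<close>

lemma sym_trunc_limit_nonpos_odd_min:
  fixes \<alpha> v :: real
  assumes \<alpha>: "0 < \<alpha>" "\<alpha> < 2"
    and f: "\<And>y. (f has_real_derivative r y) (at y)"
    and r: "\<And>y. (r has_real_derivative r' y) (at y)"
    and odd: "\<And>x. f (- x) = - f x" and per: "\<And>x. f (x + 1) = f x"
    and B: "\<And>y. \<bar>f y\<bar> \<le> B"
    and x: "0 \<le> x" "x \<le> 1 / 2" "f x \<le> 0"
    and min: "\<And>y. 0 \<le> y \<Longrightarrow> y \<le> 1 / 2 \<Longrightarrow> f x \<le> f y"
    and lim: "(\<lambda>n. sym_trunc \<alpha> r x (1 / real n) (real n)) \<longlonglongrightarrow> v"
  shows "v \<le> 0"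
proof -
  obtain F where F: "\<And>y. (F has_real_derivative f y) (at y)"
    using antiderivative_exists[OF f continuous_on_of_DERIV[OF r]] by blast
  obtain \<Phi> where \<Phi>: "\<And>y. (\<Phi> has_real_derivative F y) (at y)"
    using antiderivative_exists[OF F continuous_on_of_DERIV[OF f]] by blast
  have "\<bar>2 * f x - f (x - s) - f (x + s)\<bar> \<le> 4 * B" for s
    using B[of x] B[of "x - s"] B[of "x + s"] by linarith
  then show ?thesis
    by (rule sym_trunc_limit_nonpos_double_integral[OF \<alpha> f r F \<Phi> _ _ lim])
       (rule odd_periodic_min_second_difference[OF odd per F \<Phi> x min])
qed

section \<open>A maximum principle on a compact set\<close>

text \<open>Subtracting \<open>k * t\<close> makes the time derivative strictly negative at a
  positive space-time maximum, so a slightly earlier value would be larger. Letting the perturbation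
  tend to 0 gives the claim.\<close>

lemma compact_max_principle:
  fixes E :: "'a::topological_space \<Rightarrow> real \<Rightarrow> real"
  assumes K: "compact K"
    and cont: "continuous_on (K \<times> {0..}) (\<lambda>(x, t). E x t)"
    and init: "\<And>x. x \<in> K \<Longrightarrow> E x 0 \<le> 0"
    and step: "\<And>x t. \<lbrakk>x \<in> K; 0 < t; 0 < E x t; \<And>y. y \<in> K \<Longrightarrow> E y t \<le> E x t\<rbrakk>
      \<Longrightarrow> \<exists>d\<le>0. (E x has_real_derivative d) (at t within {0..})"
    and x: "x \<in> K" and t: "0 \<le> t"
  shows "E x t \<le> 0"
proof (rule field_le_epsilon)
  fix e :: real assume "0 < e"
  \<comment> \<open>The denominator \<open>1 + t\<close> keeps \<open>k\<close> meaningful at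
    \<open>t = 0\<close> and makes \<open>k * t <= e\<close>.\<close>
  define k where "k = e / (1 + t)"
  have k: "0 < k" "k * t \<le> e" using \<open>0 < e\<close> t by (auto simp: k_def field_simps)
  let ?G = "\<lambda>p. E (fst p) (snd p) - k * snd p"
  have "continuous_on (K \<times> {0..t}) ?G"
    using cont by (auto simp: case_prod_beta intro!: continuous_intros elim: continuous_on_subset)
  moreover have "compact (K \<times> {0..t})" "K \<times> {0..t} \<noteq> {}" using K x t by (auto intro: compact_Times)
  ultimately obtain p where p: "p \<in> K \<times> {0..t}" "\<And>q. q \<in> K \<times> {0..t} \<Longrightarrow> ?G q \<le> ?G p"
    using continuous_attains_sup[of "K \<times> {0..t}" ?G] by meson
  obtain y s where ys: "p = (y, s)" by fastforce
  have y: "y \<in> K" "0 \<le> s" "s \<le> t" using p ys by auto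
  have max: "E z w - k * w \<le> E y s - k * s" if "z \<in> K" "0 \<le> w" "w \<le> t" for z w
    using p(2)[of "(z, w)"] that ys by simp
  have "E y s - k * s \<le> 0"
  proof (rule ccontr)
    assume "\<not> E y s - k * s \<le> 0"
    then have pos: "0 < E y s - k * s" by simp
    then have "s \<noteq> 0" using init[OF y(1)] by auto
    then have "0 < s" using y by simp
    then have "0 < k * s" using k by simp
    then have "0 < E y s" using pos by simp
    moreover have "E z s \<le> E y s" if "z \<in> K" for z using max[OF that y(2,3)] by simp
    ultimately obtain d where d: "d \<le> 0" "(E y has_real_derivative d) (at s within {0..})"
      using step[OF y(1) \<open>0 < s\<close>] by blast
    have "at s within {0..} = at s"
      using \<open>0 < s\<close> by (intro at_within_interior) (simp add: interior_real_atLeast)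
    then have "((\<lambda>w. E y w - k * w) has_real_derivative d - k) (at s)"
      using d(2) by (auto intro!: derivative_eq_intros)
    moreover have "d - k < 0" using d k by simp
    ultimately obtain h where h: "0 < h" "\<And>w. 0 < w \<Longrightarrow> w < h \<Longrightarrow> E y s - k * s < E y (s - w) - k * (s - w)"
      using DERIV_neg_dec_left[of "\<lambda>w. E y w - k * w" "d - k" s] by blast
    \<comment> \<open>The step back in time stays below \<open>h\<close> and does not pass time
      0.\<close>
    define w where "w = min (h / 2) s"
    have "0 < w" "w < h" "w \<le> s" using h \<open>0 < s\<close> by (auto simp: w_def)
    then show False using h(2)[of w] max[OF y(1), of "s - w"] y by force
  qed
  then show "E x t \<le> 0 + e" using max[OF x t order_refl] k by linarith
qed

section \<open>Symmetrised principal values and periodic functions\<close>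

lemma c_alpha_nonneg:
  assumes "0 < \<alpha>" "\<alpha> < 2"
  shows "0 \<le> c_alpha \<alpha>"
  unfolding c_alpha_def using assms by (intro divide_nonneg_nonneg mult_nonneg_nonneg) auto

text \<open>The two halves of the truncated domain are carried to \<open>{\<epsilon>..R}\<close> by
  a shift and by a reflection. The kernel is odd, so the contributions of \<open>\<rho> x t\<close>
  cancel, and endpoints do not affect the integral.\<close>

lemma pv_trunc_eq_sym_trunc:
  assumes cont: "continuous_on UNIV (\<lambda>y. \<rho> y t)" and "0 < \<epsilon>"
  shows "pv_trunc \<alpha> \<rho> x t \<epsilon> R = sym_trunc \<alpha> (\<lambda>y. \<rho> y t) x \<epsilon> R"
proof -
  define F where "F y = (\<rho> y t - \<rho> x t) / (sgn (x - y) * \<bar>x - y\<bar> powr \<alpha>)" for y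
  define r l where "r z = (\<rho> x t - \<rho> (x + z) t) * z powr - \<alpha>"
    and "l z = (\<rho> (x - z) t - \<rho> x t) * z powr - \<alpha>" for z
  have c: "continuous_on {\<epsilon>..R} r" "continuous_on {\<epsilon>..R} l"
    unfolding r_def l_def using \<open>0 < \<epsilon>\<close>
    by (auto intro!: continuous_intros continuous_on_compose2[OF cont])
  obtain i j where i: "(r has_integral i) {\<epsilon>..R}" and j: "(l has_integral j) {\<epsilon>..R}"
    using c integrable_continuous_real by blast
  have "F (x + z) = r z" if "z \<in> {\<epsilon>..R}" for z
    using that \<open>0 < \<epsilon>\<close> by (simp add: F_def r_def powr_minus divide_inverse) (simp add: algebra_simps)
  then have "((F \<circ> (+) x) has_integral i) {\<epsilon>..R}"
    using has_integral_cong[of "{\<epsilon>..R}" "F \<circ> (+) x" r] i by simp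
  then have 1: "(F has_integral i) {\<epsilon> + x<..<R + x}"
    using has_integral_shift_Icc_real has_integral_Icc_iff_Ioo by blast
  have "F (x - z) = l z" if "z \<in> {\<epsilon>..R}" for z
    using that \<open>0 < \<epsilon>\<close> by (simp add: F_def l_def powr_minus divide_inverse)
  then have "((\<lambda>z. (F \<circ> (+) x) (- z)) has_integral j) {- (- \<epsilon>)..- (- R)}"
    using has_integral_cong[of "{\<epsilon>..R}" "\<lambda>z. F (x - z)" l] j by simp
  then have "((F \<circ> (+) x) has_integral j) {- R..- \<epsilon>}"
    using has_integral_reflect_real by blast
  then have 2: "(F has_integral j) {- R + x<..<- \<epsilon> + x}"
    using has_integral_shift_Icc_real has_integral_Icc_iff_Ioo by blast
  have "{y. \<epsilon> < \<bar>x - y\<bar> \<and> \<bar>x - y\<bar> < R} = {- R + x<..<- \<epsilon> + x} \<union> {\<epsilon> + x<..<R + x}"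
    using \<open>0 < \<epsilon>\<close> by (auto simp: abs_if)
  moreover have "{- R + x<..<- \<epsilon> + x} \<inter> {\<epsilon> + x<..<R + x} = {}" using \<open>0 < \<epsilon>\<close> by auto
  ultimately have "(F has_integral j + i) {y. \<epsilon> < \<bar>x - y\<bar> \<and> \<bar>x - y\<bar> < R}"
    using has_integral_Un[OF 2 1] by simp
  then have "pv_trunc \<alpha> \<rho> x t \<epsilon> R = j + i"
    unfolding pv_trunc_def F_def by (rule integral_unique)
  moreover have "((\<lambda>z. (\<rho> (x - z) t - \<rho> (x + z) t) * z powr - \<alpha>) has_integral j + i) {\<epsilon>..R}"
    using has_integral_add[OF j i] by (simp add: r_def l_def algebra_simps)
  ultimately show ?thesis by (simp add: sym_trunc_def integral_unique)
qed

lemma sym_trunc_integrable: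
  fixes f :: "real \<Rightarrow> real"
  assumes "continuous_on UNIV f" "0 < \<epsilon>"
  shows "(\<lambda>z. (f (x - z) - f (x + z)) * z powr - \<alpha>) integrable_on {\<epsilon>..R}"
  using assms(2)
  by (auto intro!: integrable_continuous_real continuous_intros continuous_on_compose2[OF assms(1)])

lemma sym_trunc_translate: "sym_trunc \<alpha> (\<lambda>y. f (y + a)) x \<epsilon> R = sym_trunc \<alpha> f (x + a) \<epsilon> R"
  by (simp add: sym_trunc_def algebra_simps)

lemma sym_trunc_reflect: "sym_trunc \<alpha> (\<lambda>y. f (- y)) x \<epsilon> R = - sym_trunc \<alpha> f (- x) \<epsilon> R"
proof -
  have "(f (- (x - z)) - f (- (x + z))) * z powr - \<alpha> = - ((f (- x - z) - f (- x + z)) * z powr - \<alpha>)" for z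
    by (simp add: algebra_simps)
  then show ?thesis unfolding sym_trunc_def by simp
qed

lemma sym_trunc_add:
  assumes "continuous_on UNIV f" "continuous_on UNIV g" "0 < \<epsilon>"
  shows "sym_trunc \<alpha> (\<lambda>y. f y + g y) x \<epsilon> R = sym_trunc \<alpha> f x \<epsilon> R + sym_trunc \<alpha> g x \<epsilon> R"
  unfolding sym_trunc_def
    integral_add[OF sym_trunc_integrable[OF assms(1,3)] sym_trunc_integrable[OF assms(2,3)], symmetric]
  by (simp add: algebra_simps)

lemma sym_trunc_cmult: "sym_trunc \<alpha> (\<lambda>y. c * f y) x \<epsilon> R = c * sym_trunc \<alpha> f x \<epsilon> R"
  unfolding sym_trunc_def integral_mult_right[symmetric] by (simp add: algebra_simps)

lemma periodic_frac:
  fixes f :: "real \<Rightarrow> 'a"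
  assumes "\<And>x. f (x + 1) = f x"
  shows "f (frac x) = f x"
proof (cases "0 \<le> \<lfloor>x\<rfloor>")
  case True
  then show ?thesis using periodic_of_nat[of f "frac x" "nat \<lfloor>x\<rfloor>"] assms by (simp add: frac_def)
next
  case False
  then show ?thesis using periodic_of_nat[of f x "nat (- \<lfloor>x\<rfloor>)"] assms by (simp add: frac_def)
qed

lemma periodic_bounded:
  fixes f :: "real \<Rightarrow> real"
  assumes "\<And>x. f (x + 1) = f x" "continuous_on UNIV f"
  obtains B where "\<And>x. \<bar>f x\<bar> \<le> B"
proof -
  have "bounded (f ` {0..1})"
    using assms(2) by (intro compact_imp_bounded compact_continuous_image) (auto intro: continuous_on_subset)
  then obtain B where "\<forall>y\<in>f ` {0..1}. \<bar>y\<bar> \<le> B" unfolding bounded_iff real_norm_def by blast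
  then have B: "\<bar>f x\<bar> \<le> B" if "x \<in> {0..1}" for x using that by blast
  have "\<bar>f x\<bar> \<le> B" for x
    using B[of "frac x"] periodic_frac[of f x, OF assms(1)] frac_lt_1[of x] by simp
  then show thesis by (rule that)
qed

lemma continuous_on_time_param:
  fixes g :: "real \<Rightarrow> real \<Rightarrow> real"
  assumes "continuous_on (UNIV \<times> {0..}) (\<lambda>(x, t). g x t)"
    and "continuous_on S f" "continuous_on S h" "\<And>p. p \<in> S \<Longrightarrow> 0 \<le> h p"
  shows "continuous_on S (\<lambda>p. g (f p) (h p))"
proof -
  have "continuous_on S (\<lambda>p. case (f p, h p) of (x, t) \<Rightarrow> g x t)"
    using assms(4) by (intro continuous_on_compose2[OF assms(1)] continuous_on_Pair assms) auto
  then show ?thesis by simp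
qed

lemma DERIV_global_max:
  fixes f :: "real \<Rightarrow> real"
  assumes "(f has_real_derivative l) (at x)" "\<And>y. f y \<le> f x"
  shows "l = 0"
  using DERIV_local_max[OF assms(1) zero_less_one] assms(2) by blast

section \<open>The transport equation in terms of the antiderivative\<close>

text \<open>The derivatives hidden in \<open>classical_solution\<close> become parameters, and the
  equation is solved for the derivative of the flux. Sign and symmetry of the initial datum enter
  only in the lemmas that need them.\<close>

locale density_transport =
  fixes \<alpha> :: real and \<rho> \<rho>x \<rho>t :: "real \<Rightarrow> real \<Rightarrow> real"
  assumes \<alpha>: "0 < \<alpha>" "\<alpha> < 2"
    and periodic: "\<And>x t. 0 \<le> t \<Longrightarrow> \<rho> (x + 1) t = \<rho> x t"
    and cont: "continuous_on (UNIV \<times> {0..}) (\<lambda>(x, t). \<rho> x t)"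
    and cont_x: "continuous_on (UNIV \<times> {0..}) (\<lambda>(x, t). \<rho>x x t)"
    and cont_t: "continuous_on (UNIV \<times> {0..}) (\<lambda>(x, t). \<rho>t x t)"
    and deriv_x: "\<And>x t. 0 \<le> t \<Longrightarrow> ((\<lambda>y. \<rho> y t) has_real_derivative \<rho>x x t) (at x)"
    and deriv_t: "\<And>x t. 0 \<le> t \<Longrightarrow> ((\<lambda>s. \<rho> x s) has_real_derivative \<rho>t x t) (at t within {0..})"
    and pv: "\<And>x t. 0 \<le> t \<Longrightarrow> pv_converges \<alpha> \<rho> x t"
    and flux: "\<And>x t. 0 < t \<Longrightarrow>
      ((\<lambda>y. \<rho> y t * velocity \<alpha> \<rho> y t) has_real_derivative - \<rho>t x t) (at x)"
begin

abbreviation u :: "real \<Rightarrow> real \<Rightarrow> real" where "u \<equiv> velocity \<alpha> \<rho>"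

definition pvlim :: "real \<Rightarrow> real \<Rightarrow> real" where
  "pvlim x t = Lim (at_right 0 \<times>\<^sub>F at_top) (\<lambda>p. pv_trunc \<alpha> \<rho> x t (fst p) (snd p))"

lemma u_eq: "u x t = c_alpha \<alpha> * pvlim x t"
  by (simp add: velocity_def pvlim_def)

lemma continuous_slice: "0 \<le> t \<Longrightarrow> continuous_on S (\<lambda>x. \<rho> x t)"
  by (rule continuous_on_of_DERIV[OF deriv_x])

text \<open>The two-parameter limit is restricted to the path with inner radius \<open>1 / n\<close>
  and outer radius \<open>n\<close>, the form in which the sign criteria are stated.\<close>

lemma pvlim_sequence:
  assumes t: "0 \<le> t"
  shows "(\<lambda>n. sym_trunc \<alpha> (\<lambda>y. \<rho> y t) x (1 / real n) (real n)) \<longlonglongrightarrow> pvlim x t"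
proof -
  let ?F = "at_right (0::real) \<times>\<^sub>F (at_top :: real filter)"
  obtain v where v: "((\<lambda>p. pv_trunc \<alpha> \<rho> x t (fst p) (snd p)) \<longlongrightarrow> v) ?F"
    using pv[OF t] unfolding pv_converges_def by blast
  moreover have "?F \<noteq> bot" by (simp add: prod_filter_eq_bot)
  ultimately have "pvlim x t = v" unfolding pvlim_def by (rule tendsto_Lim[rotated])
  have "filterlim (\<lambda>n. 1 / real n) (at_right 0) sequentially"
    unfolding filterlim_at using lim_1_over_n eventually_gt_at_top[of 0]
    by (auto elim: eventually_mono)
  then have "filterlim (\<lambda>n. (1 / real n, real n)) ?F sequentially"
    by (intro filterlim_Pair filterlim_real_sequentially)
  from filterlim_compose[OF v this]
  have "(\<lambda>n. pv_trunc \<alpha> \<rho> x t (1 / real n) (real n)) \<longlonglongrightarrow> pvlim x t"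
    by (simp add: \<open>pvlim x t = v\<close>)
  moreover have "\<forall>\<^sub>F n in sequentially. pv_trunc \<alpha> \<rho> x t (1 / real n) (real n)
      = sym_trunc \<alpha> (\<lambda>y. \<rho> y t) x (1 / real n) (real n)"
    using eventually_gt_at_top[of 0]
    by eventually_elim (intro pv_trunc_eq_sym_trunc continuous_slice t, simp)
  ultimately show ?thesis by (rule Lim_transform_eventually)
qed

lemma u_periodic: "0 \<le> t \<Longrightarrow> u (x + 1) t = u x t"
  using pvlim_sequence[of t "x + 1"] pvlim_sequence[of t x]
    sym_trunc_translate[of \<alpha> "\<lambda>y. \<rho> y t" 1 x] periodic[of t]
  by (simp add: u_eq LIMSEQ_unique)

text \<open>This is the integral of \<open>\<rho>\<close> from \<open>0\<close> to \<open>x\<close>, rescaled so that negative \<open>x\<close> need no separate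
  case.\<close>

definition Q :: "real \<Rightarrow> real \<Rightarrow> real" where
  "Q x t = x * integral {0..1} (\<lambda>s. \<rho> (s * x) t)"

lemma Q_0 [simp]: "Q 0 t = 0"
  by (simp add: Q_def)

lemma Q_deriv_x:
  assumes t: "0 \<le> t"
  shows "((\<lambda>x. Q x t) has_real_derivative \<rho> x t) (at x)"
proof -
  have "continuous_on UNIV (\<lambda>x. \<rho>x x t)"
    using t by (intro continuous_on_time_param[OF cont_x] continuous_intros) auto
  then show ?thesis unfolding Q_def using deriv_x[OF t] by (intro DERIV_radial_integral)
qed

lemma continuous_on_Q:
  assumes "continuous_on S f" "continuous_on S g" "\<And>p. p \<in> S \<Longrightarrow> 0 \<le> g p"
  shows "continuous_on S (\<lambda>p. Q (f p) (g p))"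
proof -
  have "continuous_on (S \<times> cbox 0 1) (\<lambda>(p, s). \<rho> (s * f p) (g p))"
    unfolding case_prod_beta using assms(3)
    by (intro continuous_on_time_param[OF cont] continuous_intros continuous_on_compose2[OF assms(1)]
        continuous_on_compose2[OF assms(2)]) auto
  from integral_continuous_on_param[OF this] show ?thesis
    unfolding Q_def by (auto intro!: continuous_intros assms)
qed

text \<open>Conservation of mass: the mass between 0 and \<open>x\<close> changes by the flux in at
  0 minus the flux out at \<open>x\<close>. Up to the factor \<open>x\<close>, the rescaled
  integrand is the derivative of the flux at \<open>s * x\<close>.\<close>

lemma Q_deriv_t:
  assumes t: "0 < t"
  shows "((\<lambda>s. Q x s) has_real_derivative \<rho> 0 t * u 0 t - \<rho> x t * u x t) (at t within {0..})"
proof -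
  have "((\<lambda>t. integral (cbox 0 1) (\<lambda>s. \<rho> (s * x) t)) has_real_derivative
      integral (cbox 0 1) (\<lambda>s. \<rho>t (s * x) t)) (at t within {0..})"
  proof (rule leibniz_rule_field_derivative)
    show "((\<lambda>r. \<rho> (s * x) r) has_real_derivative \<rho>t (s * x) r) (at r within {0..})" if "r \<in> {0..}" for r s
      using deriv_t that by simp
    show "(\<lambda>s. \<rho> (s * x) r) integrable_on cbox 0 1" if "r \<in> {0..}" for r
      using that by (intro integrable_continuous continuous_on_compose2[OF continuous_slice[of r UNIV]] continuous_intros) auto
    show "continuous_on ({0..} \<times> cbox 0 1) (\<lambda>(r, s). \<rho>t (s * x) r)"
      unfolding case_prod_beta
      by (intro continuous_on_time_param[OF cont_t] continuous_intros) auto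
  qed (use t in auto)
  then have d: "((\<lambda>s. Q x s) has_real_derivative x * integral {0..1} (\<lambda>s. \<rho>t (s * x) t)) (at t within {0..})"
    unfolding Q_def by (auto intro: DERIV_cmult)
  have "((\<lambda>s. x * (- \<rho>t (s * x) t)) has_integral (\<rho> (1 * x) t * u (1 * x) t - \<rho> (0 * x) t * u (0 * x) t)) {0..1}"
  proof (rule fundamental_theorem_of_calculus)
    fix s :: real
    have "((\<lambda>s. s * x) has_real_derivative x) (at s)" by (auto intro!: derivative_eq_intros)
    from DERIV_chain2[OF flux[OF t] this]
    show "((\<lambda>s. \<rho> (s * x) t * u (s * x) t) has_vector_derivative x * (- \<rho>t (s * x) t)) (at s within {0..1})"
      using has_real_derivative_iff_has_vector_derivative has_vector_derivative_at_within
      by (metis mult.commute)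
  qed simp
  from integral_unique[OF this]
  have "x * integral {0..1} (\<lambda>s. \<rho>t (s * x) t) = \<rho> 0 t * u 0 t - \<rho> x t * u x t" by simp
  then show ?thesis using d by simp
qed

text \<open>\<open>Q 1 t\<close> is the mass of one period. It cancels in the combinations of
  \<open>Q\<close> used below, which are therefore periodic although \<open>Q\<close> need not
  be.\<close>

lemma Q_add_1:
  assumes t: "0 \<le> t"
  shows "Q (x + 1) t = Q x t + Q 1 t"
proof -
  have "((\<lambda>x. Q (x + 1) t - Q x t) has_real_derivative 0) (at x)" for x
    using DERIV_diff[OF DERIV_compose_shift(1)[OF Q_deriv_x[OF t], of 1 x] Q_deriv_x[OF t, of x]]
      periodic[OF t, of x] by (simp add: add.commute[of 1])
  from DERIV_zero_imp_const[OF this, of x 0] show ?thesis by simp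
qed

lemma Q_diff_1: "0 \<le> t \<Longrightarrow> Q (x - 1) t = Q x t - Q 1 t"
  using Q_add_1[of t "x - 1"] by simp

section \<open>Nonnegativity is preserved\<close>

text \<open>The maximum principle is applied to minus the mass of the interval from \<open>a\<close>
  to \<open>a + h\<close>. At a positive maximum the fluxes through the two ends agree, so its time
  derivative is zero. With all these masses nonnegative, \<open>\<rho>\<close> cannot be negative
  anywhere.\<close>

lemma nonneg:
  assumes init: "\<And>x. 0 \<le> \<rho> x 0" and t: "0 \<le> t"
  shows "0 \<le> \<rho> x t"
proof -
  have Q_mono: "Q (fst p) s - Q (fst p + snd p) s \<le> 0" if "p \<in> {0..1} \<times> {0..1}" "0 \<le> s" for p s
  proof (rule compact_max_principle[where E = "\<lambda>p s. Q (fst p) s - Q (fst p + snd p) s"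
        and K = "{0..1} \<times> {0..1}"])
    show "continuous_on (({0..1} \<times> {0..1}) \<times> {0..}) (\<lambda>(p, s). Q (fst p) s - Q (fst p + snd p) s)"
      by (auto simp: case_prod_beta intro!: continuous_intros continuous_on_Q)
    show "Q (fst p) 0 - Q (fst p + snd p) 0 \<le> 0" if "p \<in> {0..1} \<times> {0..1}" for p
      using DERIV_nonneg_imp_nondecreasing[of "fst p" "fst p + snd p" "\<lambda>x. Q x 0"]
        Q_deriv_x[of 0] init that by force
  next
    fix p :: "real \<times> real" and s :: real
    assume p: "p \<in> {0..1} \<times> {0..1}" and s: "0 < s" and pos: "0 < Q (fst p) s - Q (fst p + snd p) s"
      and max: "\<And>q. q \<in> {0..1} \<times> {0..1} \<Longrightarrow> Q (fst q) s - Q (fst q + snd q) s \<le> Q (fst p) s - Q (fst p + snd p) s"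
    obtain a h where ah: "p = (a, h)" by fastforce
    have h: "0 < h" "h \<le> 1" and a: "0 \<le> a" "a \<le> 1" using p pos ah by (auto simp: less_le)
    have "\<rho> a s * u a s = \<rho> (a + h) s * u (a + h) s"
    \<comment> \<open>For a full period the end fluxes agree by periodicity. Otherwise the maximum
      is interior in \<open>h\<close>, which makes \<open>\<rho>\<close> vanish at
      \<open>a + h\<close>, and stationarity in \<open>a\<close> carries this zero to
      \<open>a\<close>.\<close>
    proof (cases "h = 1")
      case True
      then show ?thesis using s periodic[of s a] u_periodic[of s a] by simp
    next
      case False
      have "((\<lambda>h. Q a s - Q (a + h) s) has_real_derivative 0 - \<rho> (a + h) s) (at h)"
        using s by (intro DERIV_diff DERIV_const DERIV_compose_shift Q_deriv_x) auto
      moreover have "Q a s - Q (a + k) s \<le> Q a s - Q (a + h) s" if "\<bar>h - k\<bar> < min h (1 - h)" for k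
        using max[of "(a, k)"] that a ah by (auto simp: abs_less_iff)
      ultimately have 1: "\<rho> (a + h) s = 0"
        using DERIV_local_max[of "\<lambda>h. Q a s - Q (a + h) s" "0 - \<rho> (a + h) s" h "min h (1 - h)"] h False
        by simp
      have "((\<lambda>b. Q b s - Q (h + b) s) has_real_derivative \<rho> a s - \<rho> (h + a) s) (at a)"
        using s by (intro DERIV_diff DERIV_compose_shift Q_deriv_x) auto
      \<comment> \<open>Periodicity in the left end turns the maximum over [0, 1] into one over the
        whole line, so \<open>a = 0\<close> and \<open>a = 1\<close> need no separate
        treatment.\<close>
      moreover have "Q b s - Q (h + b) s \<le> Q a s - Q (h + a) s" for b
      proof -
        have "Q (frac b) s - Q (h + frac b) s = Q b s - Q (h + b) s"
          using periodic_frac[of "\<lambda>b. Q b s - Q (h + b) s" b] Q_add_1[of s] s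
          by (simp add: add.assoc[symmetric])
        then show ?thesis
          using max[of "(frac b, h)"] h ah frac_lt_1[of b] by (simp add: add.commute)
      qed
      ultimately have "\<rho> a s - \<rho> (h + a) s = 0" by (rule DERIV_global_max)
      then show ?thesis using 1 by (simp add: add.commute)
    qed
    then show "\<exists>d\<le>0. ((\<lambda>s. Q (fst p) s - Q (fst p + snd p) s) has_real_derivative d) (at s within {0..})"
      using DERIV_diff[OF Q_deriv_t[OF s, of a] Q_deriv_t[OF s, of "a + h"]] ah by auto
  qed (use that in \<open>auto intro: compact_Times\<close>)
  have "0 \<le> \<rho> y t" if y: "0 \<le> y" "y \<le> 1" for y
  proof (rule ccontr)
    assume "\<not> 0 \<le> \<rho> y t"
    then obtain d where d: "0 < d" "\<And>h. 0 < h \<Longrightarrow> h < d \<Longrightarrow> Q (y + h) t < Q y t"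
      using DERIV_neg_dec_right[OF Q_deriv_x[OF t, of y]] by auto
    then have "Q (y + min 1 (d / 2)) t < Q y t" by (auto simp: min_def)
    then show False using Q_mono[of "(y, min 1 (d / 2))" t] y t d(1) by auto
  qed
  from this[of "frac x"] show ?thesis
    using periodic_frac[of "\<lambda>x. \<rho> x t" x, OF periodic[OF t]] frac_lt_1[of x] by simp
qed

section \<open>Reflection symmetry is preserved\<close>

text \<open>The criterion for minima is applied to \<open>c * (Q y t + Q (- y) t)\<close>;
  reflecting the density changes the sign of its principal value, which produces the sum. The factor
  \<open>c\<close> covers minima with \<open>c = 1\<close> and maxima with
  \<open>c = - 1\<close>.\<close>

lemma pvlim_add_reflect_nonpos:
  assumes t: "0 \<le> t"
    and min: "\<And>y. c * (Q x t + Q (- x) t) \<le> c * (Q y t + Q (- y) t)"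
  shows "c * (pvlim x t + pvlim (- x) t) \<le> 0"
proof -
  let ?f = "\<lambda>y. c * (Q y t + Q (- y) t)"
  let ?r = "\<lambda>y. c * (\<rho> y t + - 1 * \<rho> (- y) t)"
  have reflect: "((\<lambda>y. h (- y)) has_real_derivative - h' (- y)) (at y)"
    if "\<And>y. (h has_real_derivative h' y) (at y)" for h h' y
    using DERIV_compose_shift(2)[OF that, of 0] by simp
  have f: "(?f has_real_derivative ?r y) (at y)" for y
    using DERIV_cmult[OF DERIV_add[OF Q_deriv_x[OF t] reflect[OF Q_deriv_x[OF t]]]] by simp
  have r: "(?r has_real_derivative c * (\<rho>x y t + - 1 * - \<rho>x (- y) t)) (at y)" for y
    by (intro DERIV_cmult DERIV_add deriv_x[OF t] reflect[OF deriv_x[OF t]])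
  have "?f (y + 1) = ?f y" for y
    using Q_add_1[OF t, of y] Q_diff_1[OF t, of "- y"] by simp
  from periodic_bounded[OF this continuous_on_of_DERIV[OF f]]
  obtain B where B: "\<And>y. \<bar>?f y\<bar> \<le> B" by blast
  have "\<bar>2 * ?f x - ?f (x - s) - ?f (x + s)\<bar> \<le> 4 * B" for s
    using B[of x] B[of "x - s"] B[of "x + s"] by linarith
  moreover have "2 * ?f x \<le> ?f (x - s) + ?f (x + s)" for s
    using min[of "x - s"] min[of "x + s"] by linarith
  moreover have "(\<lambda>n. sym_trunc \<alpha> ?r x (1 / real n) (real n)) \<longlonglongrightarrow> c * (pvlim x t + pvlim (- x) t)"
  proof (rule Lim_transform_eventually)
    show "(\<lambda>n. c * (sym_trunc \<alpha> (\<lambda>y. \<rho> y t) x (1 / real n) (real n)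
        + sym_trunc \<alpha> (\<lambda>y. \<rho> y t) (- x) (1 / real n) (real n))) \<longlonglongrightarrow> c * (pvlim x t + pvlim (- x) t)"
      by (intro tendsto_intros pvlim_sequence t)
    show "\<forall>\<^sub>F n in sequentially. c * (sym_trunc \<alpha> (\<lambda>y. \<rho> y t) x (1 / real n) (real n)
        + sym_trunc \<alpha> (\<lambda>y. \<rho> y t) (- x) (1 / real n) (real n)) = sym_trunc \<alpha> ?r x (1 / real n) (real n)"
      using eventually_gt_at_top[of 0]
    proof eventually_elim
      case (elim n)
      have "continuous_on UNIV (\<lambda>y. - 1 * \<rho> (- y) t)"
        by (intro continuous_intros continuous_on_compose2[OF continuous_slice[OF t, of UNIV]]) auto
      then show ?case
        using elim sym_trunc_cmult[of \<alpha> c] sym_trunc_cmult[of \<alpha> "- 1"]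
          sym_trunc_add[of "\<lambda>y. \<rho> y t" "\<lambda>y. - 1 * \<rho> (- y) t"]
          sym_trunc_reflect[of \<alpha> "\<lambda>y. \<rho> y t"] continuous_slice[OF t]
        by simp
    qed
  qed
  ultimately show ?thesis by (rule sym_trunc_limit_nonpos[OF \<alpha> f r])
qed

text \<open>Differences \<open>D x t - D y t\<close> are compared because the flux through \<open>0\<close> cancels in them.\<close>

lemma Q_odd:
  assumes init: "\<And>x. 0 \<le> \<rho> x 0" "\<And>x. \<rho> (- x) 0 = \<rho> x 0" and t: "0 \<le> t"
  shows "Q (- x) t = - Q x t"
proof -
  define D where "D x t = Q x t + Q (- x) t" for x t
  have D_deriv: "((\<lambda>x. D x s) has_real_derivative \<rho> x s - \<rho> (- x) s) (at x)" if "0 \<le> s" for x s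
    unfolding D_def using DERIV_add[OF Q_deriv_x[OF that] DERIV_compose_shift(2)[OF Q_deriv_x[OF that], of 0]]
    by simp
  have D_periodic: "D (x + 1) s = D x s" if "0 \<le> s" for x s
    using Q_add_1[OF that, of x] Q_diff_1[OF that, of "- x"] by (simp add: D_def)
  have D_frac: "D (frac x) s = D x s" if "0 \<le> s" for x s
    using periodic_frac[of "\<lambda>x. D x s"] D_periodic[OF that] by simp
  \<comment> \<open>Used for a pair and for the swapped pair, this makes \<open>D\<close> constant
    in space, and that constant is \<open>D 0 t = 0\<close>.\<close>
  have osc: "D (fst p) s - D (snd p) s \<le> 0" if "p \<in> {0..1} \<times> {0..1}" "0 \<le> s" for p s
  proof (rule compact_max_principle[where E = "\<lambda>p s. D (fst p) s - D (snd p) s"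
        and K = "{0..1} \<times> {0..1}"])
    show "continuous_on (({0..1} \<times> {0..1}) \<times> {0..}) (\<lambda>(p, s). D (fst p) s - D (snd p) s)"
      unfolding D_def by (auto simp: case_prod_beta intro!: continuous_intros continuous_on_Q)
    have "D x 0 = D y 0" for x y
      using DERIV_zero_imp_const[of "\<lambda>x. D x 0"] D_deriv[of 0] init(2) by simp
    then show "D (fst p) 0 - D (snd p) 0 \<le> 0" for p
      by (metis diff_self order_refl)
  next
    fix p :: "real \<times> real" and s :: real
    assume p: "p \<in> {0..1} \<times> {0..1}" and s: "0 < s"
      and max: "\<And>q. q \<in> {0..1} \<times> {0..1} \<Longrightarrow> D (fst q) s - D (snd q) s \<le> D (fst p) s - D (snd p) s"
    obtain x y where xy: "p = (x, y)" by fastforce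
    have unit: "frac z \<in> {0..1}" for z :: real using frac_lt_1[of z] by simp
    have x: "D z s \<le> D x s" for z
      using max[of "(frac z, y)"] unit[of z] p D_frac[of s z] s xy by simp
    have y: "D y s \<le> D z s" for z
      using max[of "(x, frac z)"] unit[of z] p D_frac[of s z] s xy by simp
    \<comment> \<open>The pair consists of a maximum \<open>x\<close> and a minimum \<open>y\<close>
      of \<open>D\<close>. Stationarity there lets \<open>\<rho>\<close> be factored out of the two
      reflected fluxes.\<close>
    have ex: "\<rho> (- x) s = \<rho> x s"
      using DERIV_global_max[OF D_deriv x] s by simp
    have ey: "\<rho> (- y) s = \<rho> y s"
      using DERIV_global_max[OF DERIV_minus[OF D_deriv]] y s by fastforce
    have "- 1 * (Q x s + Q (- x) s) \<le> - 1 * (Q z s + Q (- z) s)" for z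
      using x[of z] by (simp add: D_def)
    then have "- 1 * (pvlim x s + pvlim (- x) s) \<le> 0"
      using s by (intro pvlim_add_reflect_nonpos) auto
    then have ux: "0 \<le> u x s + u (- x) s"
      using c_alpha_nonneg[OF \<alpha>] by (simp add: u_eq flip: distrib_left)
    have "1 * (pvlim y s + pvlim (- y) s) \<le> 0"
      using s y unfolding D_def by (intro pvlim_add_reflect_nonpos) auto
    then have uy: "u y s + u (- y) s \<le> 0"
      using c_alpha_nonneg[OF \<alpha>] by (simp add: u_eq mult_nonneg_nonpos flip: distrib_left)
    have "0 \<le> \<rho> x s" "0 \<le> \<rho> y s" using nonneg[OF init(1)] s by auto
    then have "\<rho> y s * (u y s + u (- y) s) - \<rho> x s * (u x s + u (- x) s) \<le> 0"
      using ux uy by (simp add: mult_nonneg_nonpos order_trans[of _ 0])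
    moreover have "((\<lambda>s. D x s - D y s) has_real_derivative
       \<rho> y s * (u y s + u (- y) s) - \<rho> x s * (u x s + u (- x) s)) (at s within {0..})"
      unfolding D_def
      by (rule DERIV_cong[OF DERIV_diff[OF DERIV_add[OF Q_deriv_t[OF s] Q_deriv_t[OF s]]
              DERIV_add[OF Q_deriv_t[OF s] Q_deriv_t[OF s]]]]) (simp add: ex ey algebra_simps)
    ultimately show "\<exists>d\<le>0. ((\<lambda>s. D (fst p) s - D (snd p) s) has_real_derivative d) (at s within {0..})"
      unfolding xy fst_conv snd_conv by blast
  qed (use that in \<open>auto intro: compact_Times\<close>)
  have "D (frac x) t = D 0 t"
    using osc[of "(frac x, 0)" t] osc[of "(0, frac x)" t] frac_lt_1[of x] t by (simp add: order_antisym)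
  then show ?thesis using D_frac[OF t, of x] by (simp add: D_def)
qed

section \<open>Monotonicity on the half period is preserved\<close>

text \<open>The maximum principle is applied to \<open>- S\<close>. \<open>S\<close> vanishes on the
  boundary of [0, 1/2] x [0, 1], so a negative minimum is interior; stationarity in \<open>l\<close>
  and \<open>z\<close> then equates \<open>\<rho>\<close> at \<open>l - z\<close>, \<open>l\<close>,
  \<open>l + z\<close>, and the sign of the time derivative is that of a second difference of
  \<open>u\<close>.\<close>

lemma second_difference_nonneg:
  assumes init: "\<And>x. 0 \<le> \<rho> x 0" "\<And>x. \<rho> (- x) 0 = \<rho> x 0"
    and mono: "\<And>x y. 0 \<le> x \<Longrightarrow> x \<le> y \<Longrightarrow> y \<le> 1 / 2 \<Longrightarrow> \<rho> x 0 \<le> \<rho> y 0"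
    and t: "0 \<le> t" and x: "0 \<le> x" "x \<le> 1 / 2"
  shows "2 * Q x t \<le> Q (x - z) t + Q (x + z) t"
proof -
  note odd = Q_odd[OF init]
  define S where "S l z s = Q (l + z) s + Q (l - z) s - 2 * Q l s" for l z s
  have S_z_periodic: "S l (z + 1) s = S l z s" if "0 \<le> s" for l z s
    using Q_add_1[OF that, of "l + z"] Q_diff_1[OF that, of "l - z"] by (simp add: S_def algebra_simps)
  have S_even: "S l (- z) s = S l z s" for l z s by (simp add: S_def)
  have S_l_periodic: "S (l + 1) z s = S l z s" if "0 \<le> s" for l z s
    using Q_add_1[OF that, of "l + z"] Q_add_1[OF that, of "l - z"] Q_add_1[OF that, of l]
    by (simp add: S_def algebra_simps)
  have S_l_odd: "S (- l) z s = - S l z s" if "0 \<le> s" for l z s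
    using odd[OF that, of "l - z"] odd[OF that, of "l + z"] odd[OF that, of l] by (simp add: S_def)
  have S_deriv_l: "((\<lambda>l. S l z s) has_real_derivative \<rho> (l + z) s + \<rho> (l - z) s - 2 * \<rho> l s) (at l)"
    if "0 \<le> s" for l z s
    using DERIV_diff[OF DERIV_add[OF DERIV_compose_shift(1)[OF Q_deriv_x[OF that], of z l]
          DERIV_compose_shift(1)[OF Q_deriv_x[OF that], of "- z" l]] DERIV_cmult[OF Q_deriv_x[OF that], of 2 l]]
    by (simp add: S_def add.commute)
  have S_deriv_z: "((\<lambda>z. S l z s) has_real_derivative \<rho> (l + z) s - \<rho> (l - z) s) (at z)"
    if "0 \<le> s" for l z s
    using DERIV_diff[OF DERIV_add[OF DERIV_compose_shift(1)[OF Q_deriv_x[OF that], of l z]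
          DERIV_compose_shift(2)[OF Q_deriv_x[OF that], of l z]] DERIV_const[of "2 * Q l s"]]
    by (simp add: S_def)
  have S_half: "S (1 / 2) z s = 0" if "0 \<le> s" for z s
    using S_l_periodic[OF that, of "- 1 / 2" z] S_l_odd[OF that, of "1 / 2" z] by simp
  have neg: "- S (fst p) (snd p) s \<le> 0" if "p \<in> {0..1 / 2} \<times> {0..1}" "0 \<le> s" for p s
  proof (rule compact_max_principle[where E = "\<lambda>p s. - S (fst p) (snd p) s"
        and K = "{0..1 / 2} \<times> {0..1}"])
    show "continuous_on (({0..1 / 2} \<times> {0..1}) \<times> {0..}) (\<lambda>(p, s). - S (fst p) (snd p) s)"
      unfolding S_def by (auto simp: case_prod_beta intro!: continuous_intros continuous_on_Q)
  next
    fix p :: "real \<times> real" assume p: "p \<in> {0..1 / 2} \<times> {0..1}"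
    obtain l z where lz: "p = (l, z)" by fastforce
    have l: "0 \<le> l" "l \<le> 1 / 2" using p lz by auto
    \<comment> \<open>Evenness folds \<open>l - w\<close> to its absolute value, and with
      periodicity it folds \<open>l + w\<close> to \<open>1 - (l + w)\<close> beyond 1/2. The folded
      points lie in [0, 1/2] in the right order for \<open>mono\<close>.\<close>
    have W: "\<rho> (l - w) 0 \<le> \<rho> (l + w) 0" if w: "0 \<le> w" "w \<le> 1 / 2" for w
    proof -
      have "\<rho> (l - w) 0 = \<rho> \<bar>l - w\<bar> 0" using init(2)[of "l - w"] by (metis abs_if)
      also have "\<dots> \<le> \<rho> (l + w) 0"
      proof (cases "l + w \<le> 1 / 2")
        case True
        then show ?thesis using l w by (intro mono) auto
      next
        case False
        then have "\<rho> \<bar>l - w\<bar> 0 \<le> \<rho> (- (l + w) + 1) 0" using l w by (intro mono) auto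
        then show ?thesis using periodic[of 0 "- (l + w)"] init(2)[of "l + w"] by simp
      qed
      finally show ?thesis .
    qed
    have half: "0 \<le> S l w 0" if w: "0 \<le> w" "w \<le> 1 / 2" for w
    proof -
      have "S l 0 0 \<le> S l w 0"
        using DERIV_nonneg_imp_nondecreasing[OF w(1), of "\<lambda>w. S l w 0"] S_deriv_z[of 0 l] W w
        by (metis diff_ge_0_iff_ge order_refl order_trans)
      then show ?thesis by (simp add: S_def)
    qed
    have "0 \<le> S l z 0"
    \<comment> \<open>\<open>S\<close> is even and 1-periodic in \<open>z\<close>, so values beyond
      1/2 reduce to \<open>1 - z\<close>.\<close>
    proof (cases "z \<le> 1 / 2")
      case False
      then show ?thesis
        using half[of "1 - z"] S_z_periodic[of 0 l "- z"] S_even[of l z 0] p lz by simp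
    qed (use half p lz in auto)
    then show "- S (fst p) (snd p) 0 \<le> 0" by (simp add: lz)
  next
    fix p :: "real \<times> real" and s :: real
    assume p: "p \<in> {0..1 / 2} \<times> {0..1}" and s: "0 < s" and pos: "0 < - S (fst p) (snd p) s"
      and max: "\<And>q. q \<in> {0..1 / 2} \<times> {0..1} \<Longrightarrow> - S (fst q) (snd q) s \<le> - S (fst p) (snd p) s"
    obtain l z where lz: "p = (l, z)" by fastforce
    have s0: "0 \<le> s" using s by simp
    have neg: "S l z s < 0" using pos lz by simp
    have min: "S l z s \<le> S k w s" if "0 \<le> k" "k \<le> 1 / 2" "0 \<le> w" "w \<le> 1" for k w
      using max[of "(k, w)"] that lz by simp
    have z: "0 < z" "z < 1"
      using p lz neg S_z_periodic[OF s0, of l 0] by (auto simp: S_def less_le)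
    have "l \<noteq> 0" "l \<noteq> 1 / 2"
      using neg S_half[OF s0, of z] S_l_odd[OF s0, of 0 z] by (fastforce, metis less_irrefl)
    then have l: "0 < l" "l < 1 / 2" using p lz by auto
    have "\<rho> (l + z) s + \<rho> (l - z) s - 2 * \<rho> l s = 0"
      by (rule DERIV_local_min[OF S_deriv_l[OF s0], of "min l (1 / 2 - l)"])
         (use l z min in \<open>auto simp: abs_less_iff\<close>)
    moreover have "\<rho> (l + z) s - \<rho> (l - z) s = 0"
      by (rule DERIV_local_min[OF S_deriv_z[OF s0], of "min z (1 - z)"])
         (use l z min in \<open>auto simp: abs_less_iff\<close>)
    ultimately have e: "\<rho> (l + z) s = \<rho> l s" "\<rho> (l - z) s = \<rho> l s" by auto
    let ?v = "pvlim (l + z) s + pvlim (l - z) s - 2 * pvlim l s"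
    have "?v \<le> 0"
    proof -
      \<comment> \<open>This is the derivative of \<open>S\<close> in its first argument. For fixed
        \<open>z\<close> that function is odd and periodic with a negative minimum over the half
        period at \<open>l\<close>, as the criterion for odd functions requires.\<close>
      let ?r = "\<lambda>y. \<rho> (y + z) s + (\<rho> (y + - z) s + - 2 * \<rho> y s)"
      have f: "((\<lambda>l. S l z s) has_real_derivative ?r y) (at y)" for y
        using S_deriv_l[OF s0, of z y] by (simp add: add_diff_eq)
      have r: "(?r has_real_derivative \<rho>x (y + z) s + (\<rho>x (y + - z) s + - 2 * \<rho>x y s)) (at y)" for y
        using DERIV_add[OF DERIV_compose_shift(1)[OF deriv_x[OF s0], of z y]
          DERIV_add[OF DERIV_compose_shift(1)[OF deriv_x[OF s0], of "- z" y] DERIV_cmult[OF deriv_x[OF s0], of "- 2" y]]]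
        by (simp add: add.commute)
      obtain B where B: "\<And>y. \<bar>S y z s\<bar> \<le> B"
        using periodic_bounded[OF S_l_periodic[OF s0, of _ z] continuous_on_of_DERIV[OF f]] by blast
      have lim: "(\<lambda>n. sym_trunc \<alpha> ?r l (1 / real n) (real n)) \<longlonglongrightarrow> pvlim (l + z) s + (pvlim (l + - z) s + - 2 * pvlim l s)"
      proof (rule Lim_transform_eventually)
        let ?T = "\<lambda>x n. sym_trunc \<alpha> (\<lambda>y. \<rho> y s) x (1 / real n) (real n)"
        show "(\<lambda>n. ?T (l + z) n + (?T (l + - z) n + - 2 * ?T l n))
            \<longlonglongrightarrow> pvlim (l + z) s + (pvlim (l + - z) s + - 2 * pvlim l s)"
          by (intro tendsto_intros pvlim_sequence s0)
        show "\<forall>\<^sub>F n in sequentially. ?T (l + z) n + (?T (l + - z) n + - 2 * ?T l n)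
            = sym_trunc \<alpha> ?r l (1 / real n) (real n)"
          using eventually_gt_at_top[of 0]
        proof eventually_elim
          case (elim n)
          have c: "continuous_on UNIV (\<lambda>y. \<rho> (y + a) s)" for a
            by (intro continuous_on_compose2[OF continuous_slice[OF s0, of UNIV]] continuous_intros) auto
          have c2: "continuous_on UNIV (\<lambda>y. - 2 * \<rho> y s)"
            by (intro continuous_intros continuous_slice s0)
          have n: "0 < 1 / real n" using elim by simp
          show ?case
            unfolding sym_trunc_add[OF c[of z] continuous_on_add[OF c[of "- z"] c2] n]
              sym_trunc_add[OF c[of "- z"] c2 n] sym_trunc_cmult[of \<alpha> "- 2" "\<lambda>y. \<rho> y s"]
              sym_trunc_translate[of \<alpha> "\<lambda>y. \<rho> y s" z] sym_trunc_translate[of \<alpha> "\<lambda>y. \<rho> y s" "- z"] ..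
        qed
      qed
      have "pvlim (l + z) s + (pvlim (l + - z) s + - 2 * pvlim l s) \<le> 0"
      proof (rule sym_trunc_limit_nonpos_odd_min[where f = "\<lambda>l. S l z s" and x = l])
        show "(\<lambda>n. sym_trunc \<alpha> ?r l (1 / real n) (real n))
            \<longlonglongrightarrow> pvlim (l + z) s + (pvlim (l + - z) s + - 2 * pvlim l s)"
          by (rule lim)
        show "S (- y) z s = - S y z s" "S (y + 1) z s = S y z s" for y
          using s0 by (rule S_l_odd, rule S_l_periodic)
        show "S l z s \<le> S y z s" if "0 \<le> y" "y \<le> 1 / 2" for y
          using min that z by simp
      qed (fact \<alpha> f r B | use l neg in simp)+
      then show ?thesis unfolding add_uminus_conv_diff by linarith
    qed
    then have "c_alpha \<alpha> * ?v \<le> 0" using c_alpha_nonneg[OF \<alpha>] by (rule mult_nonneg_nonpos[rotated])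
    then have "u (l + z) s + u (l - z) s - 2 * u l s \<le> 0" by (simp add: u_eq algebra_simps)
    then have "\<rho> l s * (u (l + z) s + u (l - z) s - 2 * u l s) \<le> 0"
      using nonneg[OF init(1) s0, of l] by (intro mult_nonneg_nonpos)
    moreover have "((\<lambda>s. - S l z s) has_real_derivative
        \<rho> l s * (u (l + z) s + u (l - z) s - 2 * u l s)) (at s within {0..})"
      unfolding S_def
      by (rule DERIV_cong[OF DERIV_minus[OF DERIV_diff[OF DERIV_add[OF Q_deriv_t[OF s] Q_deriv_t[OF s]]
              DERIV_cmult[OF Q_deriv_t[OF s]]]]]) (simp add: e algebra_simps)
    ultimately show "\<exists>d\<le>0. ((\<lambda>s. - S (fst p) (snd p) s) has_real_derivative d) (at s within {0..})"
      unfolding lz fst_conv snd_conv by blast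
  qed (use that in \<open>auto intro: compact_Times\<close>)
  have "0 \<le> S x (frac z) t" using neg[of "(x, frac z)" t] x t frac_lt_1[of z] by simp
  then have "0 \<le> S x z t"
    using periodic_frac[of "\<lambda>z. S x z t", OF S_z_periodic[OF t]] by simp
  then show ?thesis by (simp add: S_def)
qed

section \<open>The sign of the velocity\<close>

text \<open>Nonnegative second differences of \<open>Q\<close> at \<open>x\<close> are the convexity
  condition of \<open>sym_trunc_limit_nonpos\<close> with \<open>f = Q\<close>; the bound on them
  comes from periodicity in the step.\<close>

lemma u_nonpos:
  assumes init: "\<And>x. 0 \<le> \<rho> x 0" "\<And>x. \<rho> (- x) 0 = \<rho> x 0"
    and mono: "\<And>x y. 0 \<le> x \<Longrightarrow> x \<le> y \<Longrightarrow> y \<le> 1 / 2 \<Longrightarrow> \<rho> x 0 \<le> \<rho> y 0"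
    and t: "0 \<le> t" and x: "0 \<le> x" "x \<le> 1 / 2"
  shows "u x t \<le> 0"
proof -
  let ?h = "\<lambda>s. 2 * Q x t - Q (x - s) t - Q (x + s) t"
  have "?h (s + 1) = ?h s" for s
    using Q_add_1[OF t, of "x + s"] Q_diff_1[OF t, of "x - s"] by (simp add: algebra_simps)
  moreover have "continuous_on UNIV ?h"
    using t by (intro continuous_intros continuous_on_Q) auto
  ultimately obtain B where "\<And>s. \<bar>?h s\<bar> \<le> B" using periodic_bounded[of ?h] by blast
  then have "pvlim x t \<le> 0"
    using sym_trunc_limit_nonpos[OF \<alpha> Q_deriv_x[OF t] deriv_x[OF t] _
        second_difference_nonneg[OF init mono t x] pvlim_sequence[OF t]] by blast
  then show ?thesis using c_alpha_nonneg[OF \<alpha>] by (simp add: u_eq mult_nonneg_nonpos)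
qed

end

theorem theorem2p6:
  fixes \<alpha> \<rho>max :: real and \<rho>0 :: "real \<Rightarrow> real" and \<rho> :: "real \<Rightarrow> real \<Rightarrow> real"
  assumes "0 < \<alpha>" "\<alpha> < 2"
    and "smooth_fun \<rho>0" "periodic1 \<rho>0"
    and H1: "\<forall>x. \<rho>0 (- x) = \<rho>0 x"
    and H2: "0 < \<rho>max" "\<forall>x. 0 \<le> \<rho>0 x \<and> \<rho>0 x \<le> \<rho>max"
    and H3: "\<rho>0 0 = 0" "\<forall>x\<in>{0..1/2}. 0 \<le> deriv \<rho>0 x"
    and "classical_solution \<alpha> \<rho>0 \<rho>"
  shows "\<forall>x\<in>{0..delta_const \<alpha>}. \<forall>t\<ge>0. velocity \<alpha> \<rho> x t \<le> 0"
proof -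
  obtain \<rho>x \<rho>t where sol:
    "continuous_on (UNIV \<times> {0..}) (\<lambda>(x, t). \<rho> x t)"
    "continuous_on (UNIV \<times> {0..}) (\<lambda>(x, t). \<rho>x x t)"
    "continuous_on (UNIV \<times> {0..}) (\<lambda>(x, t). \<rho>t x t)"
    "\<forall>x t. 0 \<le> t \<longrightarrow>
           ((\<lambda>y. \<rho> y t) has_real_derivative \<rho>x x t) (at x) \<and>
           ((\<lambda>s. \<rho> x s) has_real_derivative \<rho>t x t) (at t within {0..})"
    "\<forall>x t. 0 \<le> t \<longrightarrow> pv_converges \<alpha> \<rho> x t"
    "\<forall>x t. 0 < t \<longrightarrow>
           (\<exists>F'. ((\<lambda>y. \<rho> y t * velocity \<alpha> \<rho> y t) has_real_derivative F') (at x) \<and>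
                 \<rho>t x t + F' = 0)"
    and per: "\<forall>x t. 0 \<le> t \<longrightarrow> \<rho> (x + 1) t = \<rho> x t" and init: "\<forall>x. \<rho> x 0 = \<rho>0 x"
    using assms unfolding classical_solution_def by blast
  interpret density_transport \<alpha> \<rho> \<rho>x \<rho>t
  proof
    fix x t :: real assume "0 < t"
    then obtain F' where "((\<lambda>y. \<rho> y t * velocity \<alpha> \<rho> y t) has_real_derivative F') (at x)" "\<rho>t x t + F' = 0"
      using sol(6) by blast
    then show "((\<lambda>y. \<rho> y t * velocity \<alpha> \<rho> y t) has_real_derivative - \<rho>t x t) (at x)"
      by (metis add_eq_0_iff)
  qed (use assms sol per in auto)
  have "\<rho> x 0 \<le> \<rho> y 0" if "0 \<le> x" "x \<le> y" "y \<le> 1 / 2" for x y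
  proof -
    have "\<rho>0 differentiable at z" for z
      using \<open>smooth_fun \<rho>0\<close> unfolding smooth_fun_def by (metis funpow_0)
    then have "(\<rho>0 has_real_derivative deriv \<rho>0 z) (at z)" for z
      by (simp add: DERIV_deriv_iff_real_differentiable)
    then have "\<rho>0 x \<le> \<rho>0 y"
      using H3(2) that by (intro DERIV_nonneg_imp_nondecreasing[OF that(2)]) force
    then show ?thesis by (simp add: init)
  qed
  \<comment> \<open>\<open>delta_const\<close> is at most 1/4, so the interval lies in
    [0, 1/2].\<close>
  then show ?thesis
    using H1 H2 init by (auto intro!: u_nonpos simp: delta_const_def)
qed

end
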